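(* Let $\mathcal{A}$ be a finite alphabet and let $\eta\colon\mathbb{Z}^2\to\mathcal{A}$. Suppose there is an infinite sequence of (pairwise distinct) pairs $(n_i,k_i)$ of positive integers such that $P_\eta(n_i,k_i)\le n_ik_i$ for all $i$. Then either (1) $h(\mathbf{u})=0$ for all unit vectors $\mathbf{u}\in S^1$, or (2) there is a unique nonexpansive direction for $\eta$, which is either the direction of $\mathbf{e}_1$ or that of $\mathbf{e}_2$, and $\eta$ is periodic in this direction.
   Context: For $\mathbf{n}\in\mathbb{Z}^2$ and $x\colon\mathbb{Z}^2\to\mathcal{A}$, define $T^{\mathbf{n}}x\colon\mathbb{Z}^2\to\mathcal{A}$ by $(T^{\mathbf{n}}x)(\mathbf{m})=x(\mathbf{m}+\mathbf{n})$. For bounded $K\subset\mathbb{R}^2$, $P_\eta(K)=|\{(T^{\mathbf{n}}\eta)|_{K\cap\mathbb{Z}^2}:\mathbf{n}\in\mathbb{Z}^2\}|$, and $P_\eta(n,k)=P_\eta([0,n-1]\times[0,k-1])$. Give $\mathcal{A}$ the discrete topology and $\mathcal{A}^{\mathbb{Z}^2}$ the product topology, and let $X_\eta$ be the closure of $\{T^{\mathbf{n}}\eta:\mathbf{n}\in\mathbb{Z}^2\}$, with the $\mathbb{Z}^2$ action $T=(T^{\mathbf{n}})$ by translations and the metric $\rho(x,y)=2^{-\min\{\|\mathbf{m}\|:x(\mathbf{m})\ne y(\mathbf{m})\}}$ for $x\neq y$, $\rho(x,x)=0$ ($\|\cdot\|$ the Euclidean norm). Directional entropy: for bounded $E\subset\mathbb{R}^2$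 and $\varepsilon>0$, $N_T(E,\varepsilon)$ is the minimal cardinality of a set $Y\subset X_\eta$ such that for each $x\in X_\eta$ there is $y\in Y$ with $\rho(T^{\mathbf{n}}x,T^{\mathbf{n}}y)<\varepsilon$ for every $\mathbf{n}\in E\cap\mathbb{Z}^2$. For $t>0$, $E^{(t)}=\{\mathbf{v}\in\mathbb{R}^2:\|\mathbf{v}-\mathbf{w}\|<t\text{ for some }\mathbf{w}\in E\}$. For a unit vector $\mathbf{u}\in\mathbb{R}^2$ and $s>0$, $[0,s\mathbf{u}]=\{rs\mathbf{u}:0\le r\le1\}$. The (one-dimensional) topological directional entropy of the action $T$ on $X_\eta$ in direction $\mathbf{u}$ is $$h(\mathbf{u})=\lim_{\varepsilon\to0}\ \sup_{t>0}\ \limsup_{s\to\infty}\frac{\log N_T([0,s\mathbf{u}]^{(t)},\varepsilon)}{s}\in[0,\infty].$$ Expansiveness: a line $\ell\subset\mathbb{R}^2$ is expansive (for $\eta$, i.e. for $X_\eta$) if there is $r>0$ such that whenever $x,y\in X_\eta$ satisfy $x(\mathbf{n})=y(\mathbf{n})$ for all $\mathbf{n}\in\mathbb{Z}^2$ at Euclidean distance less than $r$ from $\ell$, then $x=y$; otherwise $\ell$ is nonexpansive. A direction, given by a nonzero vector $\mathbf{v}$ (with $\mathbf{v}$ and its nonzero real multiples giving the same direction), is nonexpansive if the line $\mathbb{R}\mathbf{v}$ is nonexpansive. $\eta$ is periodic in the direction of $\mathbf{v}$ if there is $\mathbf{m}\in\mathbb{Z}^2\setminus\{\mathbf{0}\}$,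 $\mathbf{m}\in\mathbb{R}\mathbf{v}$, with $\eta(\mathbf{m}+\mathbf{n})=\eta(\mathbf{n})$ for all $\mathbf{n}\in\mathbb{Z}^2$. $\mathbf{e}_1,\mathbf{e}_2$ are the standard basis vectors. *)

theory Defs
  imports "HOL-Analysis.Analysis"
begin

type_synonym 'a config = "int \<times> int \<Rightarrow> 'a"

text \<open>
  The plane is \<open>real \<times> real\<close>, whose library norm is the Euclidean one; lattice points
  have type \<open>int \<times> int\<close> and are embedded into the plane by \<open>pt\<close>.
\<close>

definition pt :: "int \<times> int \<Rightarrow> real \<times> real" where
  "pt m = (real_of_int (fst m), real_of_int (snd m))"

definition translate :: "int \<times> int \<Rightarrow> 'a config \<Rightarrow> 'a config" where
  "translate n x = (\<lambda>m. x (m + n))"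

definition complexity :: "'a config \<Rightarrow> (real \<times> real) set \<Rightarrow> nat" where
  "complexity \<eta> K = card {restrict (translate n \<eta>) {m. pt m \<in> K} | n. True}"

definition rect_complexity :: "'a config \<Rightarrow> nat \<Rightarrow> nat \<Rightarrow> nat" where
  "rect_complexity \<eta> n k = complexity \<eta> ({0..real n - 1} \<times> {0..real k - 1})"

definition orbit_closure :: "'a config \<Rightarrow> 'a config set" where
  "orbit_closure \<eta> =
     product_topology (\<lambda>_. discrete_topology UNIV) UNIV closure_of {translate n \<eta> | n. True}"

text \<open>For \<open>x \<noteq> y\<close> the \<open>LEAST\<close> below exists, since a ball contains only finitely many lattice points.\<close>

definition rho :: "'a config \<Rightarrow> 'a config \<Rightarrow> real" where
  "rho x y = (if x = y then 0
     else 2 powr - (LEAST r. \<exists>m. x m \<noteq> y m \<and> r = norm (pt m)))"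

definition spanning :: "'a config \<Rightarrow> (real \<times> real) set \<Rightarrow> real \<Rightarrow> 'a config set \<Rightarrow> bool" where
  "spanning \<eta> E \<epsilon> Y \<longleftrightarrow> Y \<subseteq> orbit_closure \<eta> \<and>
     (\<forall>x\<in>orbit_closure \<eta>. \<exists>y\<in>Y. \<forall>n. pt n \<in> E \<longrightarrow> rho (translate n x) (translate n y) < \<epsilon>)"

text \<open>
  For a finite alphabet, bounded \<open>E\<close> and \<open>\<epsilon> > 0\<close> a finite spanning set always exists,
  so the minimal cardinality is a natural number.
\<close>

definition span_number :: "'a config \<Rightarrow> (real \<times> real) set \<Rightarrow> real \<Rightarrow> nat" where
  "span_number \<eta> E \<epsilon> = (LEAST N. \<exists>Y. finite Y \<and> card Y = N \<and> spanning \<eta> E \<epsilon> Y)"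

definition thicken :: "(real \<times> real) set \<Rightarrow> real \<Rightarrow> (real \<times> real) set" where
  "thicken E t = {v. \<exists>w\<in>E. norm (v - w) < t}"

definition dir_entropy :: "'a config \<Rightarrow> real \<times> real \<Rightarrow> ereal" where
  "dir_entropy \<eta> u = Lim (at_right 0) (\<lambda>\<epsilon>. SUP t\<in>{0<..}. Limsup at_top (\<lambda>s.
     ereal (ln (real (span_number \<eta> (thicken (closed_segment 0 (s *\<^sub>R u)) t) \<epsilon>)) / s)))"

definition expansive :: "'a config \<Rightarrow> (real \<times> real) set \<Rightarrow> bool" where
  "expansive \<eta> L \<longleftrightarrow> (\<exists>r>0. \<forall>x\<in>orbit_closure \<eta>. \<forall>y\<in>orbit_closure \<eta>.
     (\<forall>n. infdist (pt n) L < r \<longrightarrow> x n = y n) \<longrightarrow> x = y)"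

text \<open>
  A direction is a nonzero vector up to nonzero real multiples; it is represented by
  the line through the origin \<open>span {v}\<close> that it generates.
\<close>

definition nonexpansive_directions :: "'a config \<Rightarrow> (real \<times> real) set set" where
  "nonexpansive_directions \<eta> = {span {v} | v. v \<noteq> 0 \<and> \<not> expansive \<eta> (span {v})}"

definition periodic_in_direction :: "'a config \<Rightarrow> real \<times> real \<Rightarrow> bool" where
  "periodic_in_direction \<eta> v \<longleftrightarrow>
     (\<exists>m. m \<noteq> 0 \<and> pt m \<in> span {v} \<and> (\<forall>n. \<eta> (m + n) = \<eta> n))"

end

theory Submission
  imports Defs
begin

text \<open>
  Write \<open>P(n,k)\<close> for the number of \<open>n \<times> k\<close> patterns of \<open>\<eta>\<close>. After exchanging the
  coordinates if necessary, there are pairs with \<open>n \<le> k\<close>, \<open>P(n,k) \<le> n * k\<close> and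
  \<open>k\<close> arbitrarily large. The proof shows that either \<open>\<eta>\<close> has a vertical period or the
  number of \<open>s \<times> s\<close> patterns is \<open>exp (o(s))\<close>. The second case gives entropy zero in all
  directions at once, because a thickened segment of length \<open>s\<close> lies in a square of side
  \<open>O(s)\<close> (\<open>subexp_squares_imp_dir_entropy_zero\<close>).

  The hypothesis is used in two ways. First, \<open>P(1,k) \<le> n * k \<le> k\<^sup>2\<close> for arbitrarily large
  \<open>k\<close>, so that vertical strips of any fixed width have only \<open>exp (o(N))\<close> patterns of height
  \<open>N\<close> (\<open>strip_growth\<close>). Second, for a single pair, \<open>P(0,k) = 1\<close> and
  \<open>P(n,k) \<le> n * k\<close> yield a width \<open>J\<close> with \<open>P(J+1,k) < P(J,k) + k\<close>
  (\<open>exists_cheap_column\<close>): a further column consists of \<open>k\<close> cells but produces fewer than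
  \<open>k\<close> new patterns. Two conclusions follow. Adding the cells one at a time, one of them is
  determined by the earlier ones, so that a strip of width \<open>J\<close> together with \<open>k\<close> cells of the
  next column determines that column (\<open>cheap_column_spread\<close>). And fewer than \<open>k\<close> windows of the
  strip leave the next \<open>k\<close> cells open, so that a strip in which all windows do this is
  periodic, by Morse and Hedlund (\<open>ambiguous_imp_vper\<close>). Hence a vertical strip of width
  \<open>J\<close> either determines the next column or is periodic with a period bounded in advance,
  and in the periodic case the neighbouring columns inherit a common period \<open>L\<close>. All this
  holds on finite ranges of rows, with a bounded loss at their ends (\<open>strip_rules\<close>).

  If no strip of width \<open>J\<close> is periodic on all rows, a square of side \<open>s\<close> is described by
  a strip pattern of height \<open>O(s)\<close>, as follows. If the strip at the left edge of the square is
  not periodic near the square, it determines the \<open>s\<close> columns of the square. Otherwise follow the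
  strip up or down to the first row where its period breaks, however far away that is. Around this
  row the strip determines \<open>s\<close> columns, including one period of the zone between the break
  and the square, and this zone has the period \<open>L\<close>; so the square is known once the distance
  to the break is known modulo \<open>L\<close> (\<open>card_square_patterns_le\<close>). Therefore the square has
  \<open>exp (o(s))\<close> patterns. If a strip is periodic on all rows, the period passes to all columns and
  \<open>\<eta>\<close> is periodic.

  For a configuration with a period \<open>p\<close>, every line that is not parallel to \<open>p\<close> is expansive. If
  the line along \<open>p\<close> is expansive too, then the orbit closure is finite and all entropies vanish;
  otherwise this line is the unique nonexpansive direction (\<open>periodic_dichotomy\<close>).
\<close>


section \<open>Windows and their patterns\<close>

definition agree :: "'a config \<Rightarrow> (int \<times> int) set \<Rightarrow> int \<times> int \<Rightarrow> int \<times> int \<Rightarrow> bool" where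
  "agree \<eta> S v w \<longleftrightarrow> (\<forall>m\<in>S. \<eta> (m + v) = \<eta> (m + w))"

definition window :: "'a config \<Rightarrow> (int \<times> int) set \<Rightarrow> int \<times> int \<Rightarrow> int \<times> int \<Rightarrow> 'a" where
  "window \<eta> S v = restrict (translate v \<eta>) S"

definition patterns :: "'a config \<Rightarrow> (int \<times> int) set \<Rightarrow> (int \<times> int \<Rightarrow> 'a) set" where
  "patterns \<eta> S = range (window \<eta> S)"

lemma window_eq_iff: "window \<eta> S v = window \<eta> S w \<longleftrightarrow> agree \<eta> S v w"
  unfolding window_def agree_def translate_def restrict_def fun_eq_iff by auto

lemma agree_sym: "agree \<eta> S v w \<Longrightarrow> agree \<eta> S w v"
  by (simp add: agree_def)

lemma agree_mono: "agree \<eta> S v w \<Longrightarrow> S' \<subseteq> S \<Longrightarrow> agree \<eta> S' v w"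
  by (auto simp: agree_def)

lemma agree_Un: "agree \<eta> (A \<union> B) v w \<longleftrightarrow> agree \<eta> A v w \<and> agree \<eta> B v w"
  by (auto simp: agree_def)

lemma agree_shift: "agree \<eta> S (u + v) (u + w) \<longleftrightarrow> agree \<eta> ((\<lambda>m. m + u) ` S) v w"
  unfolding agree_def by (simp add: add.assoc)

lemma complexity_eq: "complexity \<eta> K = card (patterns \<eta> {m. pt m \<in> K})"
proof -
  have "{restrict (translate n \<eta>) {m. pt m \<in> K} | n. True} = patterns \<eta> {m. pt m \<in> K}"
    unfolding patterns_def window_def by blast
  then show ?thesis by (simp add: complexity_def)
qed

lemma finite_patterns: "finite S \<Longrightarrow> finite (patterns (\<eta> :: 'a::finite config) S)"
  by (rule finite_subset[of _ "PiE S (\<lambda>_. UNIV)"])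
     (auto simp: patterns_def window_def intro: finite_PiE)

lemma finite_patterns_window: "finite S \<Longrightarrow> finite (window (\<eta> :: 'a::finite config) S ` V)"
  by (rule finite_subset[OF _ finite_patterns[of S \<eta>]]) (auto simp: patterns_def)

text \<open>
  Every counting argument below has this shape: if each point can be described by some element
  of \<open>Q\<close>, and a description determines the value of \<open>f\<close>, then \<open>f\<close> has at most \<open>card Q\<close>
  values. The description need not be unique, so none has to be chosen when the lemma is applied.
\<close>

lemma card_image_le_codes:
  assumes "finite Q" "\<And>v. v \<in> V \<Longrightarrow> \<exists>c\<in>Q. R v c"
    and "\<And>v w c. R v c \<Longrightarrow> R w c \<Longrightarrow> f v = f w"
  shows "card (f ` V) \<le> card Q"
proof -
  obtain g where g: "\<And>v. v \<in> V \<Longrightarrow> g v \<in> Q \<and> R v (g v)"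
    using assms(2) by metis
  define h where "h c = f (SOME v. v \<in> V \<and> g v = c)" for c
  have "f v \<in> h ` Q" if v: "v \<in> V" for v
  proof -
    let ?w = "SOME w. w \<in> V \<and> g w = g v"
    have "?w \<in> V \<and> g ?w = g v" by (rule someI[of _ v]) (use v in auto)
    then have "f ?w = f v" using g[OF v] g[of ?w] assms(3) by metis
    then show ?thesis using g[OF v] by (force simp: h_def)
  qed
  then show ?thesis using surj_card_le[OF assms(1), of "f ` V" h] by blast
qed

lemma card_image_factor:
  assumes "finite (g ` V)" "\<And>v w. g v = g w \<Longrightarrow> f v = f w"
  shows "card (f ` V) \<le> card (g ` V)"
  by (rule card_image_le_codes[where R = "\<lambda>v c. c = g v"]) (use assms(1) in \<open>auto intro: assms(2)\<close>)

lemma card_patterns_le_codes: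
  assumes "finite Q" "\<And>v. \<exists>c\<in>Q. R v c" "\<And>v w c. R v c \<Longrightarrow> R w c \<Longrightarrow> agree \<eta> S v w"
  shows "card (patterns \<eta> S) \<le> card Q"
  unfolding patterns_def
proof (rule card_image_le_codes[where R = R])
  fix v w c assume "R v c" "R w c"
  then show "window \<eta> S v = window \<eta> S w"
    using assms(3) window_eq_iff by blast
qed (use assms in blast)+

text \<open>
  The map \<open>\<phi>\<close> moves positions, and \<open>\<eta>'\<close> may differ from \<open>\<eta>\<close>; this covers
  enlarging or translating the window as well as transposing the configuration.
\<close>

lemma card_patterns_le:
  fixes \<eta>' :: "'a::finite config"
  assumes "finite S'" "\<And>v w. agree \<eta>' S' (\<phi> v) (\<phi> w) \<Longrightarrow> agree \<eta> S v w"
  shows "card (patterns \<eta> S) \<le> card (patterns \<eta>' S')"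
proof (rule card_patterns_le_codes[where R = "\<lambda>v c. c = window \<eta>' S' (\<phi> v)"])
  show "finite (patterns \<eta>' S')" by (rule finite_patterns[OF assms(1)])
  show "\<exists>c\<in>patterns \<eta>' S'. c = window \<eta>' S' (\<phi> v)" for v
    unfolding patterns_def by blast
  fix v w c
  assume "c = window \<eta>' S' (\<phi> v)" "c = window \<eta>' S' (\<phi> w)"
  then show "agree \<eta> S v w" using assms(2) window_eq_iff by metis
qed

lemma card_patterns_mono:
  fixes \<eta> :: "'a::finite config"
  shows "finite S' \<Longrightarrow> S \<subseteq> S' \<Longrightarrow> card (patterns \<eta> S) \<le> card (patterns \<eta> S')"
  by (rule card_patterns_le[where \<phi> = id]) (auto intro: agree_mono)

lemma patterns_empty: "card (patterns \<eta> {}) = 1"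
  by (simp add: patterns_def window_def restrict_def)

text \<open>
  A pattern on \<open>S\<close> is determined by the patterns on the translated copies of \<open>S0\<close> that
  cover it.
\<close>

lemma card_patterns_cover:
  fixes \<eta> :: "'a::finite config"
  assumes "finite I" "finite S0" "S \<subseteq> (\<Union>i\<in>I. (\<lambda>m. m + \<tau> i) ` S0)"
  shows "card (patterns \<eta> S) \<le> card (patterns \<eta> S0) ^ card I"
proof -
  have "card (patterns \<eta> S) \<le> card (PiE I (\<lambda>_. patterns \<eta> S0))"
  proof (rule card_patterns_le_codes[where R = "\<lambda>v c. c = restrict (\<lambda>i. window \<eta> S0 (\<tau> i + v)) I"])
    show "finite (PiE I (\<lambda>_. patterns \<eta> S0))"
      using assms finite_patterns by (auto intro: finite_PiE)
    show "\<exists>c\<in>PiE I (\<lambda>_. patterns \<eta> S0). c = restrict (\<lambda>i. window \<eta> S0 (\<tau> i + v)) I" for v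
      by (auto simp: patterns_def)
    fix v w c
    assume "c = restrict (\<lambda>i. window \<eta> S0 (\<tau> i + v)) I" "c = restrict (\<lambda>i. window \<eta> S0 (\<tau> i + w)) I"
    then have *: "agree \<eta> S0 (\<tau> i + v) (\<tau> i + w)" if "i \<in> I" for i
      using that window_eq_iff by (metis restrict_apply')
    show "agree \<eta> S v w"
      unfolding agree_def
    proof
      fix m assume "m \<in> S"
      then obtain i m' where "i \<in> I" "m' \<in> S0" "m = m' + \<tau> i" using assms(3) by blast
      then show "\<eta> (m + v) = \<eta> (m + w)"
        using * by (metis agree_def add.assoc)
    qed
  qed
  then show ?thesis using assms by (simp add: card_PiE)
qed

section \<open>Steps that add no information\<close>

text \<open>
  The principle behind the Morse-Hedlund theorem. Let \<open>r t\<close> record more and more information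
  as \<open>t\<close> grows. If \<open>k\<close> steps add fewer than \<open>k\<close> new values, then one of the
  steps adds none, and there the coarser record already determines the finer one.
\<close>

lemma chain_injective_step:
  fixes r :: "nat \<Rightarrow> 'e \<Rightarrow> 'f"
  assumes fin: "\<And>t. t \<le> k \<Longrightarrow> finite (r t ` E)"
    and card: "card (r k ` E) < card (r 0 ` E) + k"
    and factor: "\<And>t x y. t < k \<Longrightarrow> x \<in> E \<Longrightarrow> y \<in> E \<Longrightarrow> r (Suc t) x = r (Suc t) y \<Longrightarrow> r t x = r t y"
  shows "\<exists>t<k. \<forall>x\<in>E. \<forall>y\<in>E. r t x = r t y \<longrightarrow> r (Suc t) x = r (Suc t) y"
proof (rule ccontr)
  assume neg: "\<not> ?thesis"
  have step: "card (r t ` E) < card (r (Suc t) ` E)" if t: "t < k" for t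
  proof -
    \<comment> \<open>A collision \<open>x, y\<close> makes the value \<open>r (Suc t) x\<close> superfluous for recovering \<open>r t\<close>.\<close>
    obtain x y where xy: "x \<in> E" "y \<in> E" "r t x = r t y" "r (Suc t) x \<noteq> r (Suc t) y"
      using neg t by blast
    have "card (r t ` E) \<le> card (r (Suc t) ` (E - {z\<in>E. r (Suc t) z = r (Suc t) x}))"
    proof (rule card_image_le_codes[where R = "\<lambda>v c. v \<in> E \<and> (\<exists>u\<in>E. r t u = r t v \<and> r (Suc t) u = c)"])
      show "finite (r (Suc t) ` (E - {z\<in>E. r (Suc t) z = r (Suc t) x}))"
        using fin[of "Suc t"] t by (auto intro: finite_subset)
    next
      fix v assume v: "v \<in> E"
      show "\<exists>c\<in>r (Suc t) ` (E - {z\<in>E. r (Suc t) z = r (Suc t) x}).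
          v \<in> E \<and> (\<exists>u\<in>E. r t u = r t v \<and> r (Suc t) u = c)"
      proof (cases "r (Suc t) v = r (Suc t) x")
        case True
        then have "r t v = r t y" using factor[OF t v xy(1)] xy(3) by simp
        then show ?thesis using v xy by (intro bexI[of _ "r (Suc t) y"]) auto
      next
        case False
        then show ?thesis using v by (intro bexI[of _ "r (Suc t) v"]) auto
      qed
    next
      fix v w c
      assume "v \<in> E \<and> (\<exists>u\<in>E. r t u = r t v \<and> r (Suc t) u = c)"
        "w \<in> E \<and> (\<exists>u\<in>E. r t u = r t w \<and> r (Suc t) u = c)"
      then show "r t v = r t w" using factor[OF t] by metis
    qed
    also have "\<dots> < card (r (Suc t) ` E)"
    proof (rule psubset_card_mono)
      have "r (Suc t) x \<in> r (Suc t) ` E - r (Suc t) ` (E - {z\<in>E. r (Suc t) z = r (Suc t) x})"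
        using xy(1) by auto
      then show "r (Suc t) ` (E - {z\<in>E. r (Suc t) z = r (Suc t) x}) \<subset> r (Suc t) ` E"
        by blast
    qed (use fin[of "Suc t"] t in auto)
    finally show ?thesis .
  qed
  have "card (r 0 ` E) + t \<le> card (r t ` E)" if "t \<le> k" for t
    using that
  proof (induction t)
    case (Suc t)
    then show ?case using step[of t] by simp
  qed simp
  then show False using card by force
qed

text \<open>
  A deterministic process with at most \<open>N\<close> states repeats one of its first
  \<open>N + 1\<close> states and has a period \<open>q \<le> N\<close> from then on. Since \<open>q\<close> divides
  \<open>fact N\<close>, the latter is a period that depends on \<open>N\<close> alone.
\<close>

lemma deterministic_imp_periodic:
  fixes s :: "int \<Rightarrow> 's"
  assumes fin: "finite (s ` {a..b})" and card: "card (s ` {a..b}) \<le> N"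
    and step: "\<And>h h'. a \<le> h \<Longrightarrow> h < b \<Longrightarrow> a \<le> h' \<Longrightarrow> h' < b \<Longrightarrow> s h = s h' \<Longrightarrow> s (h + 1) = s (h' + 1)"
    and h: "a + int N \<le> h" "h + int (fact N) \<le> b"
  shows "s (h + int (fact N)) = s h"
proof -
  have "\<not> inj_on s {a..a + int N}"
  proof
    assume inj: "inj_on s {a..a + int N}"
    have "s ` {a..a + int N} \<subseteq> s ` {a..b}" using h of_nat_0_le_iff[of "fact N"] by (intro image_mono) (simp del: of_nat_fact)
    then have "card {a..a + int N} \<le> N"
      using card_mono[OF fin] card by (metis card_image[OF inj] order_trans)
    then show False by simp
  qed
  then obtain h1 h2 where h12: "a \<le> h1" "h1 < h2" "h2 \<le> a + int N" "s h1 = s h2"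
    unfolding inj_on_def by (metis atLeastAtMost_iff linorder_neqE)
  define q where "q = h2 - h1"
  have shift: "x + q \<le> b \<longrightarrow> s (x + q) = s x" if "x \<ge> h1" for x
    using that
  proof (induction x rule: int_ge_induct)
    case base
    then show ?case using h12 by (simp add: q_def)
  next
    case (step x)
    show ?case
    proof
      assume "x + 1 + q \<le> b"
      then have "s (x + q) = s x" "x + q < b" "x < b" using step h12 by (auto simp: q_def)
      then show "s (x + 1 + q) = s (x + 1)"
        using assms(3)[of "x + q" x] step h12 by (simp add: q_def algebra_simps)
    qed
  qed
  have mult: "h + int j * q \<le> b \<longrightarrow> s (h + int j * q) = s h" for j
  proof (induction j)
    case (Suc j)
    show ?case
    proof
      assume le: "h + int (Suc j) * q \<le> b"
      have q: "q > 0" using h12 by (simp add: q_def)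
      have "h + int j * q \<ge> h1" using q h h12 by (smt (verit) mult_nonneg_nonneg of_nat_0_le_iff)
      moreover have "h + int j * q + q \<le> b" using le by (simp add: algebra_simps)
      ultimately have "s (h + int j * q + q) = s (h + int j * q)" using shift by blast
      moreover have "h + int j * q \<le> b" using le q by (simp add: algebra_simps)
      ultimately show "s (h + int (Suc j) * q) = s h" using Suc by (simp add: algebra_simps)
    qed
  qed simp
  have "nat q dvd fact N" by (rule dvd_fact) (use h12 in \<open>auto simp: q_def\<close>)
  then obtain j where "fact N = nat q * j" by (auto simp: dvd_def)
  then have "int (fact N) = int j * q" using h12 by (simp add: q_def)
  then show ?thesis using mult[of j] h by simp
qed

section \<open>Vertical periods on a range of rows\<close>

text \<open>
  Vertical period \<open>p\<close> of the columns in \<open>C\<close>, on the rows from \<open>a\<close> to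
  \<open>b\<close>, all counted relative to \<open>v\<close>. The period is only required where both compared rows
  lie in the range, so the condition is vacuous on a range with at most \<open>p\<close> rows; this is why
  losing a bounded number of rows at both ends is harmless in all statements below.
\<close>

definition vper :: "'a config \<Rightarrow> int \<Rightarrow> int set \<Rightarrow> int \<Rightarrow> int \<Rightarrow> int \<times> int \<Rightarrow> bool" where
  "vper \<eta> p C a b v \<longleftrightarrow>
     (\<forall>c\<in>C. \<forall>r. a \<le> r \<longrightarrow> r + p \<le> b \<longrightarrow> \<eta> ((c, r) + v) = \<eta> ((c, r + p) + v))"

lemma vperD: "vper \<eta> p C a b v \<Longrightarrow> c \<in> C \<Longrightarrow> a \<le> r \<Longrightarrow> r + p \<le> b \<Longrightarrow>
    \<eta> ((c, r + p) + v) = \<eta> ((c, r) + v)"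
  by (simp add: vper_def)

lemma vper_mono: "vper \<eta> p C a b v \<Longrightarrow> C' \<subseteq> C \<Longrightarrow> a \<le> a' \<Longrightarrow> b' \<le> b \<Longrightarrow> vper \<eta> p C' a' b' v"
  by (auto simp: vper_def)

lemma vper_Un: "vper \<eta> p A a b v \<Longrightarrow> vper \<eta> p B a b v \<Longrightarrow> C \<subseteq> A \<union> B \<Longrightarrow> vper \<eta> p C a b v"
  by (auto simp: vper_def)

lemma vper_shift: "vper \<eta> p C a b ((x, y) + v) \<longleftrightarrow> vper \<eta> p ((+) x ` C) (a + y) (b + y) v"
proof
  assume L: "vper \<eta> p C a b ((x, y) + v)"
  show "vper \<eta> p ((+) x ` C) (a + y) (b + y) v"
    unfolding vper_def
  proof (intro ballI allI impI)
    fix c r assume "c \<in> (+) x ` C" "a + y \<le> r" "r + p \<le> b + y"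
    then show "\<eta> ((c, r) + v) = \<eta> ((c, r + p) + v)"
      using vperD[OF L, of "c - x" "r - y"] by (cases v) (auto simp: algebra_simps)
  qed
next
  assume R: "vper \<eta> p ((+) x ` C) (a + y) (b + y) v"
  show "vper \<eta> p C a b ((x, y) + v)"
    unfolding vper_def
  proof (intro ballI allI impI)
    fix c r assume "c \<in> C" "a \<le> r" "r + p \<le> b"
    then show "\<eta> ((c, r) + ((x, y) + v)) = \<eta> ((c, r + p) + ((x, y) + v))"
      using vperD[OF R, of "x + c" "r + y"] by (cases v) (auto simp: algebra_simps)
  qed
qed

lemma vper_mult:
  assumes "vper \<eta> p C a b v" "c \<in> C" "a \<le> r" "r + int j * p \<le> b" "p > 0"
  shows "\<eta> ((c, r + int j * p) + v) = \<eta> ((c, r) + v)"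
  using assms(4)
proof (induction j)
  case (Suc j)
  have "r + int j * p + p \<le> b" using Suc.prems by (simp add: algebra_simps)
  moreover have "a \<le> r + int j * p"
    using assms(3,5) by (metis add_increasing2 less_imp_le mult_nonneg_nonneg of_nat_0_le_iff)
  ultimately have "\<eta> ((c, r + int j * p + p) + v) = \<eta> ((c, r + int j * p) + v)"
    using vperD[OF assms(1,2)] by blast
  moreover have "r + int j * p \<le> b" using Suc.prems assms(5) by (simp add: algebra_simps)
  ultimately show ?case using Suc.IH by (simp add: algebra_simps)
qed simp

lemma vper_cong:
  assumes "vper \<eta> p C a b v" "c \<in> C" "p > 0" "r mod p = r' mod p"
    "a \<le> r" "r \<le> b" "a \<le> r'" "r' \<le> b"
  shows "\<eta> ((c, r) + v) = \<eta> ((c, r') + v)"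
proof -
  have *: "\<eta> ((c, r) + v) = \<eta> ((c, r') + v)"
    if h: "r mod p = r' mod p" "r \<le> r'" "a \<le> r" "r' \<le> b" for r r'
  proof -
    obtain d where d: "r' - r = p * d" using h(1)[symmetric] unfolding mod_eq_dvd_iff dvd_def by blast
    have "0 \<le> p * d" using d that(2) by linarith
    then have "d \<ge> 0" using assms(3) by (simp add: zero_le_mult_iff)
    then have r': "r' = r + int (nat d) * p" using d by (simp add: algebra_simps)
    then show ?thesis
      using vper_mult[OF assms(1,2) that(3), of "nat d"] that(4) assms(3) by metis
  qed
  show ?thesis
  proof (cases "r \<le> r'")
    case True
    show ?thesis by (rule *[OF assms(4) True assms(5) assms(8)])
  next
    case False
    then show ?thesis by (intro *[OF assms(4)[symmetric] _ assms(7) assms(6), symmetric]) simp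
  qed
qed

lemma vper_dvd:
  assumes "vper \<eta> p C a b v" "p dvd q" "p > 0" "q > 0"
  shows "vper \<eta> q C a b v"
  unfolding vper_def
proof (intro ballI allI impI)
  fix c r assume c: "c \<in> C" "a \<le> r" "r + q \<le> b"
  have "r mod p = (r + q) mod p" using assms(2) by auto
  then show "\<eta> ((c, r) + v) = \<eta> ((c, r + q) + v)"
    using vper_cong[OF assms(1) c(1) assms(3), of r "r + q"] c assms by simp
qed

section \<open>Columns that add few patterns\<close>

text \<open>
  Adding the column \<open>c\<close> to the window \<open>C \<times> {0..<k}\<close> adds \<open>k\<close> cells but
  produces fewer than \<open>k\<close> new patterns. The column \<open>c\<close> will be the right or the left
  neighbour of an interval \<open>C\<close>.
\<close>

definition cheap_column :: "'a config \<Rightarrow> int set \<Rightarrow> int \<Rightarrow> nat \<Rightarrow> bool" where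
  "cheap_column \<eta> C c k \<longleftrightarrow> finite C \<and>
     card (patterns \<eta> (insert c C \<times> {0..<int k})) < card (patterns \<eta> (C \<times> {0..<int k})) + k"

text \<open>
  If the \<open>k\<close> cells of the new column are added one at a time, fewer than \<open>k\<close> new
  patterns appear in total, so one of the cells is determined by the earlier ones.
\<close>

lemma cheap_column_chain:
  fixes \<eta> :: "'a::finite config"
  assumes cheap_column: "cheap_column \<eta> C c k"
    and U: "U 0 = {}" "\<And>t. U t \<subseteq> U (Suc t)" "U k = {0..<int k}"
    and fin: "\<And>t. finite (U t)"
  shows "\<exists>t<k. \<forall>v w. agree \<eta> (C \<times> {0..<int k}) v w \<longrightarrow> agree \<eta> ({c} \<times> U t) v w \<longrightarrow>
    agree \<eta> ({c} \<times> U (Suc t)) v w"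
proof -
  define r where "r t v = window \<eta> (C \<times> {0..<int k} \<union> {c} \<times> U t) v" for t v
  have "\<exists>t<k. \<forall>v\<in>UNIV. \<forall>w\<in>UNIV. r t v = r t w \<longrightarrow> r (Suc t) v = r (Suc t) w"
  proof (rule chain_injective_step)
    show "finite (r t ` UNIV)" for t
      unfolding r_def using cheap_column fin by (intro finite_patterns_window) (auto simp: cheap_column_def)
    have "insert c C \<times> {0..<int k} = C \<times> {0..<int k} \<union> {c} \<times> U k" using U by auto
    then show "card (range (r k)) < card (range (r 0)) + k"
      using cheap_column U(1) by (simp add: cheap_column_def patterns_def r_def)
    show "r t v = r t w" if "r (Suc t) v = r (Suc t) w" for t v w
    proof -
      have "agree \<eta> (C \<times> {0..<int k} \<union> {c} \<times> U (Suc t)) v w"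
        using that unfolding r_def window_eq_iff .
      then have "agree \<eta> (C \<times> {0..<int k} \<union> {c} \<times> U t) v w"
        by (rule agree_mono) (use U(2)[of t] in auto)
      then show ?thesis unfolding r_def window_eq_iff .
    qed
  qed
  then obtain t where t: "t < k" "\<And>v w. r t v = r t w \<Longrightarrow> r (Suc t) v = r (Suc t) w" by blast
  show ?thesis
    using t unfolding r_def window_eq_iff agree_Un by blast
qed

text \<open>
  Adding the cells of the new column from the bottom up, and in the next lemma from the top
  down, yields the rule by which knowledge of the column spreads upwards and downwards.
\<close>

lemma cheap_column_up:
  fixes \<eta> :: "'a::finite config"
  assumes "cheap_column \<eta> C c k"
  shows "\<exists>l<k. \<forall>v w. agree \<eta> (C \<times> {0..<int k}) v w \<longrightarrow> agree \<eta> ({c} \<times> {0..<int l}) v w \<longrightarrow>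
    \<eta> ((c, int l) + v) = \<eta> ((c, int l) + w)"
proof -
  have "\<exists>t<k. \<forall>v w. agree \<eta> (C \<times> {0..<int k}) v w \<longrightarrow> agree \<eta> ({c} \<times> {0..<int t}) v w \<longrightarrow>
    agree \<eta> ({c} \<times> {0..<int (Suc t)}) v w"
    by (rule cheap_column_chain[OF assms, where U = "\<lambda>t. {0..<int t}"]) auto
  then obtain t where t: "t < k" "\<And>v w. agree \<eta> (C \<times> {0..<int k}) v w \<Longrightarrow>
      agree \<eta> ({c} \<times> {0..<int t}) v w \<Longrightarrow> agree \<eta> ({c} \<times> {0..<int (Suc t)}) v w" by blast
  show ?thesis
  proof (intro exI[of _ t] conjI t(1) allI impI)
    fix v w assume "agree \<eta> (C \<times> {0..<int k}) v w" "agree \<eta> ({c} \<times> {0..<int t}) v w"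
    from t(2)[OF this] show "\<eta> ((c, int t) + v) = \<eta> ((c, int t) + w)"
      unfolding agree_def by (rule bspec) auto
  qed
qed

lemma cheap_column_down:
  fixes \<eta> :: "'a::finite config"
  assumes "cheap_column \<eta> C c k"
  shows "\<exists>l<k. \<forall>v w. agree \<eta> (C \<times> {0..<int k}) v w \<longrightarrow> agree \<eta> ({c} \<times> {int l<..<int k}) v w \<longrightarrow>
    \<eta> ((c, int l) + v) = \<eta> ((c, int l) + w)"
proof -
  have "\<exists>t<k. \<forall>v w. agree \<eta> (C \<times> {0..<int k}) v w \<longrightarrow> agree \<eta> ({c} \<times> {int k - int t..<int k}) v w \<longrightarrow>
    agree \<eta> ({c} \<times> {int k - int (Suc t)..<int k}) v w"
    by (rule cheap_column_chain[OF assms, where U = "\<lambda>t. {int k - int t..<int k}"]) auto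
  then obtain t where t: "t < k" "\<And>v w. agree \<eta> (C \<times> {0..<int k}) v w \<Longrightarrow>
      agree \<eta> ({c} \<times> {int k - int t..<int k}) v w \<Longrightarrow>
      agree \<eta> ({c} \<times> {int k - int (Suc t)..<int k}) v w" by blast
  have l: "int (k - Suc t) = int k - int t - 1" using t(1) by simp
  show ?thesis
  proof (intro exI[of _ "k - Suc t"] conjI allI impI)
    show "k - Suc t < k" using t(1) by simp
    fix v w assume "agree \<eta> (C \<times> {0..<int k}) v w" "agree \<eta> ({c} \<times> {int (k - Suc t)<..<int k}) v w"
    moreover have "{int (k - Suc t)<..<int k} = {int k - int t..<int k}" using l by auto
    ultimately have "agree \<eta> ({c} \<times> {int k - int (Suc t)..<int k}) v w" using t(2) by simp
    then show "\<eta> ((c, int (k - Suc t)) + v) = \<eta> ((c, int (k - Suc t)) + w)"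
      unfolding agree_def by (rule bspec) (use l in auto)
  qed
qed

lemma cheap_column_pos: "cheap_column (\<eta> :: 'a::finite config) C c k \<Longrightarrow> k > 0"
  using cheap_column_up[of \<eta> C c k] by auto

lemma agree_shift_rows:
  "agree \<eta> (C \<times> {a..b}) v w \<Longrightarrow> a \<le> h \<Longrightarrow> h + int k - 1 \<le> b \<Longrightarrow>
    agree \<eta> (C \<times> {0..<int k}) ((0, h) + v) ((0, h) + w)"
  unfolding agree_shift by (erule agree_mono) auto

text \<open>
  Two positions whose strips agree on a range of rows, and whose next columns agree on one block
  of \<open>k\<close> rows, have next columns that agree on the whole range, up to \<open>k\<close> rows at
  either end: the rules above extend the block cell by cell in both directions.
\<close>

lemma cheap_column_spread:
  fixes \<eta> :: "'a::finite config"
  assumes cheap_column: "cheap_column \<eta> C c k" and strip: "agree \<eta> (C \<times> {a..b}) v w"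
    and h0: "a \<le> h0" "h0 + int k - 1 \<le> b"
    and col: "agree \<eta> ({c} \<times> {0..<int k}) ((0, h0) + v) ((0, h0) + w)"
  shows "agree \<eta> ({c} \<times> {a + int k..b - int k}) v w"
proof -
  have col': "\<eta> ((c, r) + v) = \<eta> ((c, r) + w)" if "h0 \<le> r" "r < h0 + int k" for r
    using col that unfolding agree_def
    by (drule_tac bspec[of _ _ "(c, r - h0)"]) (auto simp: add.assoc[symmetric])
  have up: "r \<le> b - int k \<Longrightarrow> h0 \<le> r \<Longrightarrow> \<eta> ((c, r) + v) = \<eta> ((c, r) + w)" for r
  proof (induction "nat (r - h0)" arbitrary: r rule: less_induct)
    case less
    obtain l where l: "l < k"
      "\<And>v w. agree \<eta> (C \<times> {0..<int k}) v w \<Longrightarrow> agree \<eta> ({c} \<times> {0..<int l}) v w \<Longrightarrow>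
         \<eta> ((c, int l) + v) = \<eta> ((c, int l) + w)" using cheap_column_up[OF cheap_column] by blast
    show ?case
    proof (cases "r < h0 + int k")
      case False
      define u where "u = (0::int, r - int l)"
      have "agree \<eta> (C \<times> {0..<int k}) (u + v) (u + w)"
        unfolding u_def by (rule agree_shift_rows[OF strip]) (use False less l h0 in auto)
      moreover have "agree \<eta> ({c} \<times> {0..<int l}) (u + v) (u + w)"
        unfolding agree_shift unfolding agree_def
      proof
        fix m assume "m \<in> (\<lambda>m. m + u) ` ({c} \<times> {0..<int l})"
        then obtain i where i: "m = (c, i)" "r - int l \<le> i" "i < r" by (auto simp: u_def)
        have "\<eta> ((c, i) + v) = \<eta> ((c, i) + w)"
          by (rule less.hyps) (use i less.prems False l in auto)
        then show "\<eta> (m + v) = \<eta> (m + w)" using i by simp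
      qed
      ultimately have "\<eta> ((c, int l) + (u + v)) = \<eta> ((c, int l) + (u + w))" by (rule l(2))
      then show ?thesis by (simp add: u_def add.assoc[symmetric])
    qed (use less col' in simp)
  qed
  have down: "a + int k \<le> r \<Longrightarrow> r < h0 + int k \<Longrightarrow> \<eta> ((c, r) + v) = \<eta> ((c, r) + w)" for r
  proof (induction "nat (h0 + int k - r)" arbitrary: r rule: less_induct)
    case less
    obtain l where l: "l < k"
      "\<And>v w. agree \<eta> (C \<times> {0..<int k}) v w \<Longrightarrow> agree \<eta> ({c} \<times> {int l<..<int k}) v w \<Longrightarrow>
         \<eta> ((c, int l) + v) = \<eta> ((c, int l) + w)" using cheap_column_down[OF cheap_column] by blast
    show ?case
    proof (cases "r \<ge> h0")
      case False
      define u where "u = (0::int, r - int l)"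
      have "agree \<eta> (C \<times> {0..<int k}) (u + v) (u + w)"
        unfolding u_def by (rule agree_shift_rows[OF strip]) (use False less l h0 in auto)
      moreover have "agree \<eta> ({c} \<times> {int l<..<int k}) (u + v) (u + w)"
        unfolding agree_shift unfolding agree_def
      proof
        fix m assume "m \<in> (\<lambda>m. m + u) ` ({c} \<times> {int l<..<int k})"
        then obtain i where i: "m = (c, i)" "r < i" "i < r - int l + int k" by (auto simp: u_def)
        have "\<eta> ((c, i) + v) = \<eta> ((c, i) + w)"
          by (rule less.hyps) (use i less.prems False l in auto)
        then show "\<eta> (m + v) = \<eta> (m + w)" using i by simp
      qed
      ultimately have "\<eta> ((c, int l) + (u + v)) = \<eta> ((c, int l) + (u + w))" by (rule l(2))
      then show ?thesis by (simp add: u_def add.assoc[symmetric])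
    qed (use less col' in simp)
  qed
  show ?thesis unfolding agree_def using up down by force
qed

section \<open>Windows that do not determine the next column\<close>

definition ambiguous :: "'a config \<Rightarrow> int set \<Rightarrow> int \<Rightarrow> nat \<Rightarrow> int \<times> int \<Rightarrow> bool" where
  "ambiguous \<eta> C c k v \<longleftrightarrow>
     (\<exists>w. agree \<eta> (C \<times> {0..<int k}) v w \<and> \<not> agree \<eta> ({c} \<times> {0..<int k}) v w)"

text \<open>
  Every value of \<open>f\<close> is refined by at least one value of the finer \<open>g\<close>, and a value that
  is split is refined by at least two.
\<close>

lemma card_split_classes_le:
  assumes fin: "finite (range g)" and factor: "\<And>v w. g v = g w \<Longrightarrow> f v = f w"
  shows "card (f ` {v. \<exists>w. f v = f w \<and> g v \<noteq> g w}) + card (range f) \<le> card (range g)"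
proof -
  let ?B = "{v. \<exists>w. f v = f w \<and> g v \<noteq> g w}"
  \<comment> \<open>Two disjoint sections of the projection \<open>\<pi>\<close> from values of \<open>g\<close> to values of
    \<open>f\<close>; the second is defined over the split values only.\<close>
  define s where "s x = g (SOME v. f v = x)" for x
  define t where "t x = g (SOME w. f w = x \<and> g w \<noteq> s x)" for x
  define \<pi> where "\<pi> y = f (SOME v. g v = y)" for y
  have \<pi>g: "\<pi> (g v) = f v" for v
    unfolding \<pi>_def by (rule factor) (rule someI[of "\<lambda>w. g w = g v" v], rule refl)
  have \<pi>s: "\<pi> (s x) = x" if "x \<in> range f" for x
  proof -
    have "f (SOME v. f v = x) = x" by (rule someI_ex) (use that in auto)
    then show ?thesis by (simp add: s_def \<pi>g)
  qed
  have t: "\<pi> (t x) = x \<and> t x \<noteq> s x" if x: "x \<in> f ` ?B" for x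
  proof -
    obtain v w where vw: "x = f v" "f v = f w" "g v \<noteq> g w" using x by blast
    have "\<exists>w. f w = x \<and> g w \<noteq> s x" using vw by metis
    then have "f (SOME w. f w = x \<and> g w \<noteq> s x) = x \<and> g (SOME w. f w = x \<and> g w \<noteq> s x) \<noteq> s x"
      by (rule someI_ex)
    then show ?thesis by (simp add: t_def \<pi>g)
  qed
  have sub: "s ` range f \<subseteq> range g" "t ` f ` ?B \<subseteq> range g" by (auto simp: s_def t_def)
  have "card (s ` range f) = card (range f)"
    by (rule card_image, rule inj_on_inverseI) (rule \<pi>s)
  moreover have "card (t ` f ` ?B) = card (f ` ?B)"
    by (rule card_image, rule inj_on_inverseI[where g = \<pi>]) (use t in blast)
  moreover have "s ` range f \<inter> t ` f ` ?B = {}"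
  proof -
    have False if "x \<in> range f" "y \<in> f ` ?B" "s x = t y" for x y
      using \<pi>s[OF that(1)] t[OF that(2)] that(3) by metis
    then show ?thesis by blast
  qed
  ultimately have "card (s ` range f \<union> t ` f ` ?B) = card (f ` ?B) + card (range f)"
    using sub fin by (subst card_Un_disjoint) (auto intro: finite_subset)
  then show ?thesis using card_mono[OF fin, of "s ` range f \<union> t ` f ` ?B"] sub by auto
qed

lemma card_ambiguous_less:
  fixes \<eta> :: "'a::finite config"
  assumes "cheap_column \<eta> C c k"
  shows "card (window \<eta> (C \<times> {0..<int k}) ` {v. ambiguous \<eta> C c k v}) < k"
proof -
  let ?f = "window \<eta> (C \<times> {0..<int k})" and ?g = "window \<eta> (insert c C \<times> {0..<int k})"
  have split: "insert c C \<times> {0..<int k} = C \<times> {0..<int k} \<union> {c} \<times> {0..<int k}" by auto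
  have amb: "{v. ambiguous \<eta> C c k v} = {v. \<exists>w. ?f v = ?f w \<and> ?g v \<noteq> ?g w}"
    unfolding ambiguous_def window_eq_iff split agree_Un by blast
  have "card (?f ` {v. \<exists>w. ?f v = ?f w \<and> ?g v \<noteq> ?g w}) + card (range ?f) \<le> card (range ?g)"
  proof (rule card_split_classes_le)
    show "finite (range ?g)" using assms by (intro finite_patterns_window) (auto simp: cheap_column_def)
    show "?f v = ?f w" if "?g v = ?g w" for v w
      using that unfolding window_eq_iff by (rule agree_mono) auto
  qed
  then show ?thesis using assms unfolding amb cheap_column_def patterns_def by linarith
qed

text \<open>
  There are fewer than \<open>k\<close> ambiguous windows. If all windows on a range of rows are
  ambiguous, then the strip has fewer than \<open>k\<close> windows of height \<open>k\<close> there, and it is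
  periodic by the argument of Morse and Hedlund.
\<close>

lemma ambiguous_imp_vper:
  fixes \<eta> :: "'a::finite config"
  assumes cheap_column: "cheap_column \<eta> C c k"
    and amb: "\<And>h. a \<le> h \<Longrightarrow> h + int k - 1 \<le> b \<Longrightarrow> ambiguous \<eta> C c k ((0, h) + v)"
  shows "vper \<eta> (int (fact k)) C (a + int k) (b - int k) v"
proof -
  define e where "e = b - int k + 1"
  define r where "r t h = window \<eta> (C \<times> {0..<int t}) ((0, h) + v)" for t h
  have fin: "finite (r t ` {a..e})" for t
  proof -
    have "r t ` {a..e} \<subseteq> patterns \<eta> (C \<times> {0..<int t})" by (auto simp: r_def patterns_def)
    then show ?thesis using finite_patterns cheap_column by (metis finite_subset cheap_column_def finite_SigmaI finite_atLeastLessThan_int)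
  qed
  have factor: "r t h = r t h'" if "r t' h = r t' h'" "t \<le> t'" for t t' h h'
    using that(1) unfolding r_def window_eq_iff by (rule agree_mono) (use that(2) in auto)
  have kcard: "card (r k ` {a..e}) < k"
  proof -
    have "r k ` {a..e} \<subseteq> window \<eta> (C \<times> {0..<int k}) ` {v. ambiguous \<eta> C c k v}"
      using amb by (auto simp: r_def e_def)
    then show ?thesis
      using card_ambiguous_less[OF cheap_column] cheap_column
      by (meson card_mono finite_SigmaI finite_atLeastLessThan_int finite_patterns_window le_less_trans cheap_column_def)
  qed
  show ?thesis
  proof (cases "a \<le> e")
    case False
    have "\<not> r + int (fact k) \<le> b - int k" if "a + int k \<le> r" for r
      using that False of_nat_0_le_iff[of "fact k"] unfolding e_def by linarith
    then show ?thesis unfolding vper_def by blast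
  next
    case True
    \<comment> \<open>Windows of height 0 have one value and those of height \<open>k\<close> fewer than \<open>k\<close>, so
      for some \<open>t < k\<close> each \<open>t\<close> rows determine the row above them. As \<open>t = 0\<close>
      is possible, the state of the process consists of \<open>t + 1\<close> rows.\<close>
    have "r 0 ` {a..e} = {r 0 a}" using True by (auto simp: r_def window_eq_iff agree_def)
    then have "card (r k ` {a..e}) < card (r 0 ` {a..e}) + k" using kcard by simp
    then obtain t where t: "t < k" "\<And>x y. x \<in> {a..e} \<Longrightarrow> y \<in> {a..e} \<Longrightarrow> r t x = r t y \<Longrightarrow> r (Suc t) x = r (Suc t) y"
      using chain_injective_step[of k r "{a..e}", OF fin] factor by (metis le_SucI order_refl)
    have le: "card (r (Suc t) ` {a..e}) \<le> k"
    proof -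
      have "card (r (Suc t) ` {a..e}) \<le> card (r k ` {a..e})"
        by (rule card_image_factor[OF fin]) (erule factor, use t(1) in simp)
      then show ?thesis using kcard by simp
    qed
    have per: "r (Suc t) (h + int (fact k)) = r (Suc t) h" if "a + int k \<le> h" "h + int (fact k) \<le> e" for h
    proof (rule deterministic_imp_periodic[OF fin le _ that])
      fix h h' assume *: "a \<le> h" "h < e" "a \<le> h'" "h' < e" "r (Suc t) h = r (Suc t) h'"
      have "r t (h + 1) = r t (h' + 1)"
        unfolding r_def window_eq_iff agree_def
      proof
        fix m assume "m \<in> C \<times> {0..<int t}"
        then obtain i j where m: "m = (i, j)" "i \<in> C" "0 \<le> j" "j < int t" by auto
        have "agree \<eta> (C \<times> {0..<int (Suc t)}) ((0, h) + v) ((0, h') + v)"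
          using *(5) by (simp only: r_def window_eq_iff)
        then have "\<eta> ((i, j + 1) + ((0, h) + v)) = \<eta> ((i, j + 1) + ((0, h') + v))"
          unfolding agree_def by (rule bspec) (use m in auto)
        then show "\<eta> (m + ((0, h + 1) + v)) = \<eta> (m + ((0, h' + 1) + v))"
          using m(1) by (simp add: add.assoc[symmetric]) (simp add: algebra_simps)
      qed
      then show "r (Suc t) (h + 1) = r (Suc t) (h' + 1)" using t(2) * by simp
    qed
    show ?thesis
      unfolding vper_def
    proof (intro ballI allI impI)
      fix i h assume i: "i \<in> C" "a + int k \<le> h" "h + int (fact k) \<le> b - int k"
      have "agree \<eta> (C \<times> {0..<int (Suc t)}) ((0, h + int (fact k)) + v) ((0, h) + v)"
        using per[of h] i unfolding r_def window_eq_iff e_def by simp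
      then have "\<eta> ((i, 0) + ((0, h + int (fact k)) + v)) = \<eta> ((i, 0) + ((0, h) + v))"
        unfolding agree_def by (rule bspec) (use i in auto)
      then show "\<eta> ((i, h) + v) = \<eta> ((i, h + int (fact k)) + v)"
        by (simp add: add.assoc[symmetric])
    qed
  qed
qed

text \<open>
  The key alternative. A window that is not ambiguous forces the next columns to agree on one block
  of \<open>k\<close> rows, hence on the range; if there is none, the strip is periodic.
\<close>

lemma cheap_column_determined_or_vper:
  fixes \<eta> :: "'a::finite config"
  assumes cheap_column: "cheap_column \<eta> C c k" and strip: "agree \<eta> (C \<times> {a..b}) v w"
  shows "agree \<eta> ({c} \<times> {a + int k..b - int k}) v w \<or> vper \<eta> (int (fact k)) C (a + int k) (b - int k) v"
proof (cases "\<exists>h. a \<le> h \<and> h + int k - 1 \<le> b \<and> \<not> ambiguous \<eta> C c k ((0, h) + v)")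
  case True
  then obtain h where h: "a \<le> h" "h + int k - 1 \<le> b" "\<not> ambiguous \<eta> C c k ((0, h) + v)" by blast
  then have "agree \<eta> ({c} \<times> {0..<int k}) ((0, h) + v) ((0, h) + w)"
    using agree_shift_rows[OF strip h(1,2)] unfolding ambiguous_def by blast
  then show ?thesis using cheap_column_spread[OF cheap_column strip h(1,2)] by blast
next
  case False
  then show ?thesis using ambiguous_imp_vper[OF cheap_column] by blast
qed

section \<open>Propagation of a vertical period\<close>

text \<open>
  Along a strip with period \<open>p\<close>, the rule \<open>cheap_column_up\<close> makes the next column a deterministic
  process, whose states consist of the row modulo \<open>p\<close> and the last \<open>k\<close> cells.
\<close>

lemma vper_next_column:
  fixes \<eta> :: "'a::finite config"
  assumes cheap_column: "cheap_column \<eta> C c k" and per: "vper \<eta> p C a b v" and p: "p > 0"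
  defines "N \<equiv> nat p * CARD('a) ^ k"
  shows "vper \<eta> (int (fact N)) {c} (a + int N) (b - 2 * int k) v"
proof -
  define e where "e = b - 2 * int k"
  define s where "s h = (h mod p, restrict (\<lambda>t. \<eta> ((c, t + h) + v)) {0..<int k})" for h
  have k: "k > 0" by (rule cheap_column_pos[OF cheap_column])
  obtain l where l: "l < k" and rule: "\<And>v w. agree \<eta> (C \<times> {0..<int k}) v w \<Longrightarrow>
      agree \<eta> ({c} \<times> {0..<int l}) v w \<Longrightarrow> \<eta> ((c, int l) + v) = \<eta> ((c, int l) + w)"
    using cheap_column_up[OF cheap_column] by blast
  let ?S = "{0..<p} \<times> PiE {0..<int k} (\<lambda>_. UNIV :: 'a set)"
  have sub: "s ` {a..e} \<subseteq> ?S" using p by (auto simp: s_def)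
  have finS: "finite ?S" by (intro finite_cartesian_product finite_PiE) auto
  have cardS: "card ?S = N" by (simp add: card_cartesian_product card_PiE N_def)
  have per_s: "s (h + int (fact N)) = s h" if "a + int N \<le> h" "h + int (fact N) \<le> e" for h
  proof (rule deterministic_imp_periodic[OF _ _ _ that])
    show "finite (s ` {a..e})" using sub finS by (rule finite_subset)
    show "card (s ` {a..e}) \<le> N" using card_mono[OF finS sub] cardS by simp
    fix h h' assume h: "a \<le> h" "h < e" "a \<le> h'" "h' < e" "s h = s h'"
    have mod: "h mod p = h' mod p" using h(5) by (simp add: s_def)
    have col: "\<eta> ((c, t + h) + v) = \<eta> ((c, t + h') + v)" if "0 \<le> t" "t < int k" for t
    proof -
      have "restrict (\<lambda>t. \<eta> ((c, t + h) + v)) {0..<int k} = restrict (\<lambda>t. \<eta> ((c, t + h') + v)) {0..<int k}"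
        using h(5) by (simp only: s_def prod.inject)
      from fun_cong[OF this, of t] show ?thesis using that by simp
    qed
    \<comment> \<open>The rule determines row \<open>l\<close> of a window; placing the window \<open>k - l\<close> rows higher
      makes that row the one just above the recorded cells.\<close>
    have top: "\<eta> ((c, int k + h) + v) = \<eta> ((c, int k + h') + v)"
    proof -
      define q where "q = int k - int l"
      have "agree \<eta> (C \<times> {0..<int k}) ((0, q + h) + v) ((0, q + h') + v)"
        unfolding agree_def
      proof
        fix m assume "m \<in> C \<times> {0..<int k}"
        then obtain i j where m: "m = (i, j)" "i \<in> C" "0 \<le> j" "j < int k" by auto
        have "(j + q + h) mod p = (j + q + h') mod p" using mod by (intro mod_add_cong) auto
        then have "\<eta> ((i, j + q + h) + v) = \<eta> ((i, j + q + h') + v)"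
          by (rule vper_cong[OF per m(2) p]) (use m h l in \<open>auto simp: q_def e_def\<close>)
        then show "\<eta> (m + ((0, q + h) + v)) = \<eta> (m + ((0, q + h') + v))"
          using m(1) by (simp add: add.assoc[symmetric])
      qed
      moreover have "agree \<eta> ({c} \<times> {0..<int l}) ((0, q + h) + v) ((0, q + h') + v)"
        unfolding agree_def
      proof
        fix m assume "m \<in> {c} \<times> {0..<int l}"
        then obtain j where m: "m = (c, j)" "0 \<le> j" "j < int l" by auto
        have "\<eta> ((c, (j + q) + h) + v) = \<eta> ((c, (j + q) + h') + v)"
          by (rule col) (use m l in \<open>auto simp: q_def\<close>)
        then show "\<eta> (m + ((0, q + h) + v)) = \<eta> (m + ((0, q + h') + v))"
          using m(1) by (simp add: add.assoc[symmetric])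
      qed
      ultimately have "\<eta> ((c, int l) + ((0, q + h) + v)) = \<eta> ((c, int l) + ((0, q + h') + v))"
        by (rule rule)
      then show ?thesis by (simp add: q_def add.assoc[symmetric])
    qed
    have "\<eta> ((c, t + (h + 1)) + v) = \<eta> ((c, t + (h' + 1)) + v)" if t: "0 \<le> t" "t < int k" for t
    proof (cases "t + 1 < int k")
      case True
      have "\<eta> ((c, (t + 1) + h) + v) = \<eta> ((c, (t + 1) + h') + v)"
        by (rule col) (use True t in auto)
      moreover have "(t + 1) + h = t + (h + 1)" "(t + 1) + h' = t + (h' + 1)" by auto
      ultimately show ?thesis by simp
    next
      case False
      then have "t + (h + 1) = int k + h" "t + (h' + 1) = int k + h'" using t by auto
      then show ?thesis using top by (simp only:)
    qed
    then have "restrict (\<lambda>t. \<eta> ((c, t + (h + 1)) + v)) {0..<int k}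
        = restrict (\<lambda>t. \<eta> ((c, t + (h' + 1)) + v)) {0..<int k}"
      by (intro restrict_ext) simp
    moreover have "(h + 1) mod p = (h' + 1) mod p" using mod by (intro mod_add_cong) auto
    ultimately show "s (h + 1) = s (h' + 1)" by (simp only: s_def)
  qed
  show ?thesis
    unfolding vper_def
  proof (intro ballI allI impI)
    fix i h assume i: "i \<in> {c}" "a + int N \<le> h" "h + int (fact N) \<le> b - 2 * int k"
    have "restrict (\<lambda>t. \<eta> ((c, t + (h + int (fact N))) + v)) {0..<int k}
        = restrict (\<lambda>t. \<eta> ((c, t + h) + v)) {0..<int k}"
      using per_s[of h] i by (simp only: s_def prod.inject e_def)
    from fun_cong[OF this, of 0] show "\<eta> ((i, h) + v) = \<eta> ((i, h + int (fact N)) + v)"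
      using i k by simp
  qed
qed

text \<open>
  The period must not grow from one column to the next, so that it can be carried across
  arbitrarily many columns. If all windows are ambiguous, the strip has the period \<open>fact k\<close>,
  whatever \<open>L\<close> is, and the preceding lemma yields the period \<open>L\<close> for the next column.
  Otherwise some window determines its neighbour; then the next columns at \<open>v\<close> and at
  \<open>(0, L) + v\<close> agree near it, because the strips agree, and the agreement spreads.
\<close>

lemma cheap_column_vper_step:
  fixes \<eta> :: "'a::finite config"
  assumes cheap_column: "cheap_column \<eta> C c k"
  defines "N \<equiv> fact k * CARD('a) ^ k"
  defines "L \<equiv> int (fact N)"
  defines "D \<equiv> int N + 3 * int k + L"
  assumes per: "vper \<eta> L C a b v"
  shows "vper \<eta> L {c} (a + D) (b - D) v"
proof (cases "\<exists>h. a \<le> h \<and> h + int k - 1 \<le> b \<and> \<not> ambiguous \<eta> C c k ((0, h) + v)")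
  case False
  then have "vper \<eta> (int (fact k)) C (a + int k) (b - int k) v"
    using ambiguous_imp_vper[OF cheap_column] by blast
  moreover have "int (fact k) > 0" by (simp only: of_nat_0_less_iff fact_gt_zero)
  ultimately have "vper \<eta> (int (fact (nat (int (fact k)) * CARD('a) ^ k))) {c}
      (a + int k + int (nat (int (fact k)) * CARD('a) ^ k)) (b - int k - 2 * int k) v"
    by (rule vper_next_column[OF cheap_column])
  then have "vper \<eta> L {c} (a + int k + int N) (b - int k - 2 * int k) v"
    unfolding L_def N_def nat_int .
  then show ?thesis
    by (rule vper_mono) (auto simp: D_def L_def simp del: of_nat_fact)
next
  case True
  then obtain h0 where h0: "a \<le> h0" "h0 + int k - 1 \<le> b" "\<not> ambiguous \<eta> C c k ((0, h0) + v)"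
    by blast
  have L: "L > 0" unfolding L_def by (simp only: of_nat_0_less_iff fact_gt_zero)
  show ?thesis
  proof (cases "a + 2 * L + int k \<le> b")
    case False
    have "\<not> r + L \<le> b - D" if "a + D \<le> r" for r
      using that False L unfolding D_def by linarith
    then show ?thesis unfolding vper_def by blast
  next
    case True
    let ?w = "(0, L) + v"
    have strip: "agree \<eta> (C \<times> {a..b - L}) v ?w"
      unfolding agree_def
    proof
      fix m assume "m \<in> C \<times> {a..b - L}"
      then obtain i j where m: "m = (i, j)" "i \<in> C" "a \<le> j" "j \<le> b - L" by auto
      then show "\<eta> (m + v) = \<eta> (m + ?w)"
        using vperD[OF per, of i j] by (simp add: add.assoc[symmetric])
    qed
    \<comment> \<open>Near the top of the range, the window at \<open>h0\<close> is viewed as the shift by \<open>L\<close> of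
      the window at \<open>h0 - L\<close>.\<close>
    have "\<exists>h1. a \<le> h1 \<and> h1 + int k - 1 \<le> b - L \<and>
      (\<not> ambiguous \<eta> C c k ((0, h1) + v) \<or> \<not> ambiguous \<eta> C c k ((0, h1) + ?w))"
    proof (cases "h0 + L + int k - 1 \<le> b")
      case True
      then show ?thesis using h0 by (intro exI[of _ h0]) auto
    next
      case False
      have "(0, h0 - L) + ?w = (0, h0) + v" by (simp add: add.assoc[symmetric])
      with h0(3) have "\<not> ambiguous \<eta> C c k ((0, h0 - L) + ?w)" by (simp only: not_False_eq_True)
      moreover have "a \<le> h0 - L" "h0 - L + int k - 1 \<le> b - L"
        using h0 False \<open>a + 2 * L + int k \<le> b\<close> L by auto
      ultimately show ?thesis by blast
    qed
    then obtain h1 where h1: "a \<le> h1" "h1 + int k - 1 \<le> b - L"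
      "\<not> ambiguous \<eta> C c k ((0, h1) + v) \<or> \<not> ambiguous \<eta> C c k ((0, h1) + ?w)" by blast
    have "agree \<eta> ({c} \<times> {0..<int k}) ((0, h1) + v) ((0, h1) + ?w)"
      using agree_shift_rows[OF strip h1(1,2)] h1(3) agree_sym unfolding ambiguous_def by blast
    from cheap_column_spread[OF cheap_column strip h1(1,2) this]
    have col: "agree \<eta> ({c} \<times> {a + int k..b - L - int k}) v ?w" .
    show ?thesis
      unfolding vper_def
    proof (intro ballI allI impI)
      fix i r assume i: "i \<in> {c}" "a + D \<le> r" "r + L \<le> b - D"
      have "\<eta> ((i, r) + v) = \<eta> ((i, r) + ?w)"
        using col unfolding agree_def by (rule bspec) (use i L in \<open>auto simp: D_def\<close>)
      then show "\<eta> ((i, r) + v) = \<eta> ((i, r + L) + v)" by (simp add: add.assoc[symmetric])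
    qed
  qed
qed

text \<open>
  What the sequel uses about strips of width \<open>J\<close>: a period of the strip passes to both
  neighbouring columns, and a strip without the period \<open>L\<close> determines its right neighbour,
  at the cost of \<open>D\<close> rows at either end of the range.
\<close>

locale strip_rules =
  fixes \<eta> :: "'a::finite config" and J L D :: int
  assumes L_pos: "L > 0" and D_nonneg: "D \<ge> 0"
    and vper_right: "\<And>a b v. vper \<eta> L {0..<J} a b v \<Longrightarrow> vper \<eta> L {J} (a + D) (b - D) v"
    and vper_left: "\<And>a b v. vper \<eta> L {0..<J} a b v \<Longrightarrow> vper \<eta> L {-1} (a + D) (b - D) v"
    and determined: "\<And>a b v w. agree \<eta> ({0..<J} \<times> {a..b}) v w \<Longrightarrow>
      agree \<eta> ({J} \<times> {a + D..b - D}) v w \<or> vper \<eta> L {0..<J} (a + D) (b - D) v"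

lemma cheap_columns_imp_strip_rules:
  fixes \<eta> :: "'a::finite config"
  assumes right: "cheap_column \<eta> {0..<J} J k" and left: "cheap_column \<eta> {0..<J} (-1) k"
  shows "\<exists>L D. strip_rules \<eta> J L D"
proof -
  define N where "N = fact k * CARD('a) ^ k"
  define L where "L = int (fact N)"
  define D where "D = int N + 3 * int k + L"
  have L: "L > 0" unfolding L_def by (simp only: of_nat_0_less_iff fact_gt_zero)
  have D: "D \<ge> int k" using L by (simp add: D_def)
  have "k \<le> fact k" by (rule fact_ge_self)
  also have "fact k \<le> N" by (simp add: N_def)
  finally have dvd: "int (fact k) dvd L"
    unfolding L_def by (simp only: int_dvd_int_iff fact_dvd)
  have f: "int (fact k) > 0" by (simp only: of_nat_0_less_iff fact_gt_zero)
  have "strip_rules \<eta> J L D"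
  proof
    show "L > 0" by (rule L)
    show "D \<ge> 0" using D by linarith
    show "vper \<eta> L {J} (a + D) (b - D) v" if "vper \<eta> L {0..<J} a b v" for a b v
      using cheap_column_vper_step[OF right] that unfolding L_def D_def N_def by blast
    show "vper \<eta> L {-1} (a + D) (b - D) v" if "vper \<eta> L {0..<J} a b v" for a b v
      using cheap_column_vper_step[OF left] that unfolding L_def D_def N_def by blast
    fix a b v w assume "agree \<eta> ({0..<J} \<times> {a..b}) v w"
    from cheap_column_determined_or_vper[OF right this]
    show "agree \<eta> ({J} \<times> {a + D..b - D}) v w \<or> vper \<eta> L {0..<J} (a + D) (b - D) v"
    proof
      assume "agree \<eta> ({J} \<times> {a + int k..b - int k}) v w"
      then have "agree \<eta> ({J} \<times> {a + D..b - D}) v w" by (rule agree_mono) (use D in auto)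
      then show ?thesis ..
    next
      assume "vper \<eta> (int (fact k)) {0..<J} (a + int k) (b - int k) v"
      then have "vper \<eta> L {0..<J} (a + int k) (b - int k) v" by (rule vper_dvd[OF _ dvd f L])
      then have "vper \<eta> L {0..<J} (a + D) (b - D) v" by (rule vper_mono) (use D in auto)
      then show ?thesis ..
    qed
  qed
  then show ?thesis by blast
qed

section \<open>Strips that determine many columns\<close>

context strip_rules
begin

lemma vper_right_iter:
  "vper \<eta> L {0..<J} a b v \<Longrightarrow> vper \<eta> L {0..<J + int s} (a + int s * D) (b - int s * D) v"
proof (induction s)
  case (Suc s)
  have IH: "vper \<eta> L {0..<J + int s} (a + int s * D) (b - int s * D) v" using Suc by blast
  have "(+) (int s) ` {0..<J} \<subseteq> {0..<J + int s}" by auto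
  then have "vper \<eta> L {0..<J} (a + int s * D) (b - int s * D) ((int s, 0) + v)"
    unfolding vper_shift using vper_mono[OF IH] by simp
  from vper_right[OF this]
  have "vper \<eta> L {int s + J} (a + int (Suc s) * D) (b - int (Suc s) * D) v"
    unfolding vper_shift by (simp add: algebra_simps)
  moreover have "vper \<eta> L {0..<J + int s} (a + int (Suc s) * D) (b - int (Suc s) * D) v"
    by (rule vper_mono[OF IH]) (use D_nonneg in \<open>auto simp: algebra_simps\<close>)
  ultimately show ?case by (rule vper_Un) auto
qed simp

lemma vper_left_iter:
  "vper \<eta> L {0..<J} a b ((int i, 0) + v) \<Longrightarrow> vper \<eta> L {0..<J} (a + int i * D) (b - int i * D) v"
proof (induction i arbitrary: v)
  case (Suc i)
  have "((int (Suc i), 0) + v) = ((int i, 0) + ((1, 0) + v))" by (simp add: add.assoc[symmetric])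
  then have IH: "vper \<eta> L {0..<J} (a + int i * D) (b - int i * D) ((1, 0) + v)"
    using Suc by metis
  from vper_left[OF this]
  have "vper \<eta> L {0} (a + int (Suc i) * D) (b - int (Suc i) * D) v"
    unfolding vper_shift by (simp add: algebra_simps)
  moreover have "vper \<eta> L ((+) 1 ` {0..<J}) (a + int (Suc i) * D) (b - int (Suc i) * D) v"
    using IH unfolding vper_shift
    by (rule vper_mono) (use D_nonneg in \<open>auto simp: algebra_simps\<close>)
  ultimately show ?case by (rule vper_Un) (auto simp: image_iff)
qed (simp add: zero_prod_def[symmetric])

text \<open>
  Any column is reached by going left from the strip and then right, and a strip that is periodic on
  all rows loses nothing on the way.
\<close>

lemma globally_periodic:
  assumes "\<And>a b. vper \<eta> L {0..<J} a b v"
  shows "\<eta> (m + (0, L)) = \<eta> m"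
proof -
  define c where "c = fst m - fst v"
  define i where "i = nat \<bar>c\<bar>"
  define u where "u = (- int i, 0) + v"
  have iu: "(int i, 0) + u = v" by (simp add: u_def add.assoc[symmetric] zero_prod_def[symmetric])
  have left: "vper \<eta> L {0..<J} a b u" for a b
    using vper_left_iter[of "a - int i * D" "b + int i * D" i u] assms iu by simp
  define s where "s = nat (c + int i + \<bar>J\<bar> + 1)"
  define r where "r = snd m - snd v"
  have "vper \<eta> L {0..<J + int s} r (r + L) u"
    using vper_right_iter[OF left[of "r - int s * D" "r + L + int s * D"], of s] by simp
  moreover have "c + int i \<in> {0..<J + int s}" by (auto simp: s_def i_def)
  ultimately have "\<eta> ((c + int i, r + L) + u) = \<eta> ((c + int i, r) + u)"
    by (rule vperD) auto
  then show ?thesis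
    by (cases m, cases v) (simp add: u_def c_def r_def)
qed

text \<open>
  A strip that is not periodic determines the next \<open>s\<close> columns. If the process stopped at a
  periodic strip \<open>i\<close> columns to the right, then the period would travel back to the
  original strip. Each direction costs at most \<open>s * D\<close> rows, whence the factor 2.
\<close>

lemma determined_iter:
  assumes strip: "agree \<eta> ({0..<J} \<times> {a..b}) v w"
    and nper: "\<not> vper \<eta> L {0..<J} (a + 2 * (int s * D)) (b - 2 * (int s * D)) v"
  shows "i \<le> s \<Longrightarrow> agree \<eta> ({0..<J + int i} \<times> {a + int i * D..b - int i * D}) v w"
proof (induction i)
  case (Suc i)
  have IH: "agree \<eta> ({0..<J + int i} \<times> {a + int i * D..b - int i * D}) v w" using Suc by simp
  have "agree \<eta> ({0..<J} \<times> {a + int i * D..b - int i * D}) ((int i, 0) + v) ((int i, 0) + w)"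
    unfolding agree_shift by (rule agree_mono[OF IH]) auto
  from determined[OF this]
  show ?case
  proof
    assume "agree \<eta> ({J} \<times> {a + int i * D + D..b - int i * D - D}) ((int i, 0) + v) ((int i, 0) + w)"
    then have "agree \<eta> ({J + int i} \<times> {a + int (Suc i) * D..b - int (Suc i) * D}) v w"
      unfolding agree_shift
    proof (rule agree_mono)
      show "{J + int i} \<times> {a + int (Suc i) * D..b - int (Suc i) * D}
          \<subseteq> (\<lambda>m. m + (int i, 0)) ` ({J} \<times> {a + int i * D + D..b - int i * D - D})"
        by (auto simp: image_iff algebra_simps)
    qed
    moreover have "agree \<eta> ({0..<J + int i} \<times> {a + int (Suc i) * D..b - int (Suc i) * D}) v w"
      by (rule agree_mono[OF IH]) (use D_nonneg in \<open>auto simp: algebra_simps\<close>)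
    ultimately have "agree \<eta> ({0..<J + int i} \<times> {a + int (Suc i) * D..b - int (Suc i) * D}
        \<union> {J + int i} \<times> {a + int (Suc i) * D..b - int (Suc i) * D}) v w"
      by (simp add: agree_Un)
    then show ?thesis by (rule agree_mono) auto
  next
    assume "vper \<eta> L {0..<J} (a + int i * D + D) (b - int i * D - D) ((int i, 0) + v)"
    from vper_left_iter[OF this]
    have "vper \<eta> L {0..<J} (a + int i * D + D + int i * D) (b - int i * D - D - int i * D) v" .
    then have "vper \<eta> L {0..<J} (a + 2 * (int s * D)) (b - 2 * (int s * D)) v"
    proof (rule vper_mono)
      have "int i * D + D + int i * D = (2 * int i + 1) * D" by (simp add: algebra_simps)
      also have "\<dots> \<le> (2 * int s) * D" using Suc.prems D_nonneg by (intro mult_right_mono) auto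
      finally have *: "int i * D + D + int i * D \<le> 2 * (int s * D)" by simp
      show "a + int i * D + D + int i * D \<le> a + 2 * (int s * D)"
        "b - 2 * (int s * D) \<le> b - int i * D - D - int i * D" using * by linarith+
    qed simp
    with nper show ?thesis by blast
  qed
qed (use strip in simp)

end

section \<open>Counting square patterns\<close>

context strip_rules
begin

text \<open>
  Position, relative to a break of the period, of a block of \<open>L\<close> rows inside the periodic zone: the
  zone lies below the break for \<open>\<sigma> = 1\<close> and above it for \<open>\<sigma> = 2\<close>. The distance
  \<open>s * D\<close> is what the period loses on its way across \<open>s\<close> columns.
\<close>

definition block_offset :: "nat \<Rightarrow> nat \<Rightarrow> int" where
  "block_offset s \<sigma> = (if \<sigma> = 1 then - (int s * D) - L else int s * D)"

text \<open>
  Of the three terms \<open>s * D\<close>, two are lost when \<open>determined_iter\<close> needs the strip not to be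
  periodic; the rows that witness this, the square and the block lie within the remaining ones.
\<close>

definition radius :: "nat \<Rightarrow> int" where
  "radius s = 3 * (int s * D) + L + int s"

text \<open>
  A description of the square at \<open>v\<close> by the window of the left edge strip around some row
  \<open>y\<close> where the strip is not periodic. For \<open>\<sigma> = 0\<close> it is the bottom row of the
  square. For \<open>\<sigma> = 1\<close> and \<open>\<sigma> = 2\<close> the row may be arbitrarily far away, but a single
  periodic zone contains the square and a block near \<open>y\<close>, so that only \<open>\<rho> = y mod L\<close>
  has to be remembered. The window therefore has height \<open>O(s)\<close> although \<open>y\<close> is unbounded.
\<close>

definition described :: "nat \<Rightarrow> int \<times> int \<Rightarrow> nat \<times> int \<times> (int \<times> int \<Rightarrow> 'a) \<Rightarrow> bool" where
  "described s v = (\<lambda>(\<sigma>, \<rho>, f). \<exists>y.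
     f = window \<eta> ({0..<J} \<times> {- radius s..radius s}) ((0, y) + v) \<and>
     \<not> vper \<eta> L {0..<J} (2 * (int s * D) - radius s) (radius s - 2 * (int s * D)) ((0, y) + v) \<and>
     \<rho> = y mod L \<and>
     (if \<sigma> = 0 then y = 0 else
       \<exists>A B. vper \<eta> L {0..<J + int s} A B v \<and> A \<le> 0 \<and> int s \<le> B \<and>
         A \<le> y + block_offset s \<sigma> \<and> y + block_offset s \<sigma> + L \<le> B))"

text \<open>
  The window of the strip determines the columns of the square near the row \<open>y\<close>. In the
  cases with \<open>\<sigma> \<noteq> 0\<close> this includes a whole block of the periodic zone, from which the zone and
  the square in it are reconstructed.
\<close>

lemma described_agree:
  assumes v: "described s v c" and w: "described s w c" and J: "J \<ge> 0"
  shows "agree \<eta> ({0..<int s} \<times> {0..<int s}) v w"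
proof -
  define M where "M = int s * D"
  have M: "M \<ge> 0" using D_nonneg by (simp add: M_def)
  have R: "radius s = 3 * M + L + int s" by (simp add: radius_def M_def)
  obtain \<sigma> \<rho> f where c: "c = (\<sigma>, \<rho>, f)" by (metis prod_cases3)
  obtain y where y: "f = window \<eta> ({0..<J} \<times> {- radius s..radius s}) ((0, y) + v)"
     "\<not> vper \<eta> L {0..<J} (2 * M - radius s) (radius s - 2 * M) ((0, y) + v)" "\<rho> = y mod L"
     "if \<sigma> = 0 then y = 0 else
       \<exists>A B. vper \<eta> L {0..<J + int s} A B v \<and> A \<le> 0 \<and> int s \<le> B \<and>
         A \<le> y + block_offset s \<sigma> \<and> y + block_offset s \<sigma> + L \<le> B"
    using v unfolding described_def c M_def by auto
  obtain z where z: "f = window \<eta> ({0..<J} \<times> {- radius s..radius s}) ((0, z) + w)"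
     "\<rho> = z mod L"
     "if \<sigma> = 0 then z = 0 else
       \<exists>A B. vper \<eta> L {0..<J + int s} A B w \<and> A \<le> 0 \<and> int s \<le> B \<and>
         A \<le> z + block_offset s \<sigma> \<and> z + block_offset s \<sigma> + L \<le> B"
    using w unfolding described_def c by auto
  have "agree \<eta> ({0..<J} \<times> {- radius s..radius s}) ((0, y) + v) ((0, z) + w)"
    using y(1) z(1) window_eq_iff by metis
  moreover have "\<not> vper \<eta> L {0..<J} (- radius s + 2 * (int s * D)) (radius s - 2 * (int s * D)) ((0, y) + v)"
    using y(2) by (simp add: M_def add.commute)
  ultimately have "agree \<eta> ({0..<J + int s} \<times> {- radius s + M..radius s - M}) ((0, y) + v) ((0, z) + w)"
    unfolding M_def using determined_iter[where i = s and s = s] by blast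
  then have near: "\<eta> ((i, r + y) + v) = \<eta> ((i, r + z) + w)"
    if "0 \<le> i" "i < int s" "- (2 * M) - L - int s \<le> r" "r \<le> 2 * M + L + int s" for i r
    using that R J unfolding agree_def
    by (drule_tac bspec[of _ _ "(i, r)"]) (auto simp: add.assoc[symmetric])
  show ?thesis
  proof (cases "\<sigma> = 0")
    case True
    then have "y = 0" "z = 0" using y z by auto
    then show ?thesis using near M L_pos by (auto simp: agree_def)
  next
    case False
    define off where "off = block_offset s \<sigma>"
    have off: "- M - L \<le> off" "off \<le> M" 
      using M L_pos unfolding off_def block_offset_def M_def[symmetric] by auto
    obtain A B where AB: "vper \<eta> L {0..<J + int s} A B v" "A \<le> 0" "int s \<le> B"
      "A \<le> y + off" "y + off + L \<le> B" using y(4) False by (auto simp: off_def)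
    obtain A' B' where AB': "vper \<eta> L {0..<J + int s} A' B' w" "A' \<le> 0" "int s \<le> B'"
      "A' \<le> z + off" "z + off + L \<le> B'" using z(3) False by (auto simp: off_def)
    show ?thesis
      unfolding agree_def
    proof
      fix m assume "m \<in> {0..<int s} \<times> {0..<int s}"
      then obtain i r where m: "m = (i, r)" "0 \<le> i" "i < int s" "0 \<le> r" "r < int s" by auto
      have yz: "y mod L = z mod L" using y(3) z(2) by simp
      \<comment> \<open>The row of the block that is congruent to \<open>r\<close> modulo \<open>L\<close>. Relative to the break
        it is the same row for \<open>v\<close> and for \<open>w\<close>.\<close>
      define d where "d = (r - y - off) mod L"
      have d: "0 \<le> d" "d < L" using L_pos by (auto simp: d_def)
      have dz: "d = (r - z - off) mod L" unfolding d_def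
        using yz by (intro mod_diff_cong) auto
      have i: "i \<in> {0..<J + int s}" using m J by auto
      have "(off + d + y) mod L = (off + (r - y - off) + y) mod L"
        unfolding d_def by (intro mod_add_cong refl) (rule mod_mod_trivial)
      then have ry: "r mod L = (off + d + y) mod L" by simp
      have "(off + d + z) mod L = (off + (r - z - off) + z) mod L"
        unfolding dz by (intro mod_add_cong refl) (rule mod_mod_trivial)
      then have rz: "r mod L = (off + d + z) mod L" by simp
      have "\<eta> ((i, r) + v) = \<eta> ((i, off + d + y) + v)"
        by (rule vper_cong[OF AB(1) i L_pos ry]) (use AB m d in auto)
      also have "\<dots> = \<eta> ((i, off + d + z) + w)"
        by (rule near) (use m d off M in auto)
      also have "\<dots> = \<eta> ((i, r) + w)"
        by (rule vper_cong[OF AB'(1) i L_pos rz[symmetric]]) (use AB' m d in auto)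
      finally show "\<eta> (m + v) = \<eta> (m + w)" using m by simp
    qed
  qed
qed

text \<open>
  If the left edge strip is periodic around the square, it is not periodic on all rows, since
  otherwise \<open>\<eta>\<close> would be periodic. So the periodic zone ends either above or
  below, and the row where it ends serves as \<open>y\<close>.
\<close>

lemma exists_description:
  assumes nper: "\<exists>m. \<eta> (m + (0, L)) \<noteq> \<eta> m"
  shows "\<exists>\<sigma> y. described s v (\<sigma>, y mod L, window \<eta> ({0..<J} \<times> {- radius s..radius s}) ((0, y) + v)) \<and> \<sigma> \<le> 2"
proof -
  define M where "M = int s * D"
  have M: "M \<ge> 0" using D_nonneg by (simp add: M_def)
  have R: "radius s = 3 * M + L + int s" by (simp add: radius_def M_def)
  have intro: "?thesis"
    if "\<sigma> \<le> 2" "\<not> vper \<eta> L {0..<J} a b ((0, y) + v)" "- M - L - int s \<le> a" "b \<le> M + L + int s"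
      "if \<sigma> = 0 then y = 0 else
       \<exists>A B. vper \<eta> L {0..<J + int s} A B v \<and> A \<le> 0 \<and> int s \<le> B \<and>
         A \<le> y + block_offset s \<sigma> \<and> y + block_offset s \<sigma> + L \<le> B" for \<sigma> y a b
  proof -
    have "\<not> vper \<eta> L {0..<J} (2 * M - radius s) (radius s - 2 * M) ((0, y) + v)"
    proof
      assume "vper \<eta> L {0..<J} (2 * M - radius s) (radius s - 2 * M) ((0, y) + v)"
      then have "vper \<eta> L {0..<J} a b ((0, y) + v)"
        by (rule vper_mono) (use that R in auto)
      then show False using that by blast
    qed
    then have "described s v (\<sigma>, y mod L, window \<eta> ({0..<J} \<times> {- radius s..radius s}) ((0, y) + v))"
      using that(5) unfolding described_def M_def case_prod_conv by blast
    then show ?thesis using that(1) by blast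
  qed
  define lo where "lo = - M - L"
  define hi where "hi = int s + L + M"
  have lohi: "lo \<le> hi" using M L_pos by (simp add: lo_def hi_def)
  show ?thesis
  proof (cases "vper \<eta> L {0..<J} lo hi v")
    case False
    then show ?thesis
      by (intro intro[of 0 lo hi 0]) (auto simp: lo_def hi_def zero_prod_def[symmetric])
  next
    case per: True
    show ?thesis
    proof (cases "\<exists>n. \<not> vper \<eta> L {0..<J} lo (hi + int n) v")
      case True
      define n where "n = (LEAST n. \<not> vper \<eta> L {0..<J} lo (hi + int n) v)"
      have n: "\<not> vper \<eta> L {0..<J} lo (hi + int n) v"
        unfolding n_def using True by (rule LeastI_ex)
      have "n \<noteq> 0" using n per by (metis add.right_neutral of_nat_0)
      then have "n - 1 < n" by simp
      then have "vper \<eta> L {0..<J} lo (hi + int (n - 1)) v"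
        unfolding n_def using not_less_Least by blast
      moreover define y where "y = hi + int (n - 1)"
      ultimately have up: "vper \<eta> L {0..<J} lo y v" by simp
      have y1: "y + 1 = hi + int n" "y \<ge> hi" using \<open>n \<noteq> 0\<close> by (auto simp: y_def)
      have "\<not> vper \<eta> L {0..<J} (1 - L) 1 ((0, y) + v)"
      proof
        assume "vper \<eta> L {0..<J} (1 - L) 1 ((0, y) + v)"
        then have new: "vper \<eta> L {0..<J} (1 - L + y) (y + 1) v"
          unfolding vper_shift by (simp add: add.commute)
        have "vper \<eta> L {0..<J} lo (y + 1) v"
          unfolding vper_def
        proof (intro ballI allI impI)
          fix c r assume "c \<in> {0..<J}" "lo \<le> r" "r + L \<le> y + 1"
          then show "\<eta> ((c, r) + v) = \<eta> ((c, r + L) + v)"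
            using vperD[OF up, of c r] vperD[OF new, of c r] by (cases "r + L \<le> y") auto
        qed
        then show False using n y1 by simp
      qed
      moreover have "vper \<eta> L {0..<J + int s} (lo + M) (y - M) v"
        unfolding M_def by (rule vper_right_iter[OF up])
      then have "\<exists>A B. vper \<eta> L {0..<J + int s} A B v \<and> A \<le> 0 \<and> int s \<le> B \<and>
          A \<le> y + block_offset s 1 \<and> y + block_offset s 1 + L \<le> B"
        using y1 M L_pos
        by (intro exI[of _ "lo + M"] exI[of _ "y - M"])
          (auto simp: block_offset_def M_def[symmetric] lo_def hi_def)
      ultimately show ?thesis
        using M L_pos by (intro intro[of 1 "1 - L" 1 y]) auto
    next
      case False
      then have ups: "vper \<eta> L {0..<J} lo b v" if "b \<ge> hi" for b
        using that by (metis add.commute diff_add_cancel zle_iff_zadd)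
      have "\<not> (\<forall>a b. vper \<eta> L {0..<J} a b v)" using globally_periodic nper by blast
      then obtain a b where ab: "\<not> vper \<eta> L {0..<J} a b v" by blast
      define B where "B = max b hi"
      have "\<not> vper \<eta> L {0..<J} (lo - int (nat (lo - a))) B v"
        using ab vper_mono[of \<eta> L "{0..<J}" "lo - int (nat (lo - a))" B v "{0..<J}" a b]
        by (auto simp: B_def)
      then have ex: "\<exists>n. \<not> vper \<eta> L {0..<J} (lo - int n) B v" by blast
      define n where "n = (LEAST n. \<not> vper \<eta> L {0..<J} (lo - int n) B v)"
      have n: "\<not> vper \<eta> L {0..<J} (lo - int n) B v"
        unfolding n_def using ex by (rule LeastI_ex)
      have "vper \<eta> L {0..<J} lo B v" by (rule ups) (simp add: B_def)
      then have "n \<noteq> 0" using n by (metis diff_zero of_nat_0)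
      then have "n - 1 < n" by simp
      then have "vper \<eta> L {0..<J} (lo - int (n - 1)) B v"
        unfolding n_def using not_less_Least by blast
      moreover define y where "y = lo - int (n - 1)"
      ultimately have down: "vper \<eta> L {0..<J} y B v" by simp
      have y1: "y - 1 = lo - int n" "y \<le> lo" using \<open>n \<noteq> 0\<close> by (auto simp: y_def)
      have "\<not> vper \<eta> L {0..<J} (- 1) (L - 1) ((0, y) + v)"
      proof
        assume "vper \<eta> L {0..<J} (- 1) (L - 1) ((0, y) + v)"
        then have new: "vper \<eta> L {0..<J} (y - 1) (y + L - 1) v"
          unfolding vper_shift by (simp add: algebra_simps)
        have "vper \<eta> L {0..<J} (y - 1) B v"
          unfolding vper_def
        proof (intro ballI allI impI)
          fix c r assume "c \<in> {0..<J}" "y - 1 \<le> r" "r + L \<le> B"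
          then show "\<eta> ((c, r) + v) = \<eta> ((c, r + L) + v)"
            using vperD[OF down, of c r] vperD[OF new, of c r] by (cases "y \<le> r") auto
        qed
        then show False using n y1 by simp
      qed
      moreover have "vper \<eta> L {0..<J + int s} (y + M) (B - M) v"
        unfolding M_def by (rule vper_right_iter[OF down])
      then have "\<exists>A B. vper \<eta> L {0..<J + int s} A B v \<and> A \<le> 0 \<and> int s \<le> B \<and>
          A \<le> y + block_offset s 2 \<and> y + block_offset s 2 + L \<le> B"
        using y1 M L_pos max.cobounded2[of hi b]
        by (intro exI[of _ "y + M"] exI[of _ "B - M"])
          (auto simp: block_offset_def M_def[symmetric] lo_def hi_def B_def)
      ultimately show ?thesis
        using M L_pos by (intro intro[of 2 "- 1" "L - 1" y]) auto
    qed
  qed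
qed

lemma card_square_patterns_le:
  assumes nper: "\<exists>m. \<eta> (m + (0, L)) \<noteq> \<eta> m" and J: "J \<ge> 0"
  shows "card (patterns \<eta> ({0..<int s} \<times> {0..<int s}))
    \<le> 3 * nat L * card (patterns \<eta> ({0..<J} \<times> {- radius s..radius s}))"
proof -
  let ?W = "{0..<J} \<times> {- radius s..radius s}"
  let ?Q = "{0..2::nat} \<times> {0..<L} \<times> patterns \<eta> ?W"
  have "card (patterns \<eta> ({0..<int s} \<times> {0..<int s})) \<le> card ?Q"
  proof (rule card_patterns_le_codes[where R = "described s"])
    show "finite ?Q" by (intro finite_cartesian_product finite_patterns) auto
    fix v
    obtain \<sigma> y where *: "described s v (\<sigma>, y mod L, window \<eta> ?W ((0, y) + v))" "\<sigma> \<le> 2"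
      using exists_description[OF nper] by blast
    have "(\<sigma>, y mod L, window \<eta> ?W ((0, y) + v)) \<in> ?Q"
      using L_pos *(2) by (auto simp: patterns_def)
    with *(1) show "\<exists>c\<in>?Q. described s v c" by blast
  qed (use described_agree J in blast)
  also have "card ?Q = 3 * nat L * card (patterns \<eta> ?W)"
    by (simp add: card_cartesian_product)
  finally show ?thesis .
qed

end

section \<open>Growth of the number of patterns\<close>

lemma rect_complexity_eq:
  "rect_complexity \<eta> n k = card (patterns \<eta> ({0..<int n} \<times> {0..<int k}))"
proof -
  have "{m. pt m \<in> {0..real n - 1} \<times> {0..real k - 1}} = {0..<int n} \<times> {0..<int k}"
    by (auto simp: pt_def)
  then show ?thesis by (simp add: rect_complexity_def complexity_eq)
qed

text \<open>
  As the number of columns grows from 0 to \<open>n\<close>, the number of patterns grows from 1 to at most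
  \<open>n * k\<close>, so one of the \<open>n\<close> steps adds fewer than \<open>k\<close> patterns. The count
  depends on the width only, so the new column may be put on either side.
\<close>

lemma exists_cheap_column:
  fixes \<eta> :: "'a::finite config"
  assumes "card (patterns \<eta> ({0..<int n} \<times> {0..<int k})) \<le> n * k"
  shows "\<exists>j. cheap_column \<eta> {0..<int j} (int j) k \<and> cheap_column \<eta> {0..<int j} (-1) k"
proof -
  define P where "P j = card (patterns \<eta> ({0..<int j} \<times> {0..<int k}))" for j
  have "\<exists>j<n. P (Suc j) < P j + k"
  proof (rule ccontr)
    assume neg: "\<not> ?thesis"
    have "1 + j * k \<le> P j" if "j \<le> n" for j
      using that
    proof (induction j)
      case 0
      then show ?case by (simp add: P_def patterns_empty)
    next
      case (Suc j)
      then have "P j + k \<le> P (Suc j)" using neg by (meson Suc_le_eq not_less)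
      then show ?case using Suc by simp
    qed
    from this[of n] assms show False by (simp add: P_def)
  qed
  then obtain j where j: "P (Suc j) < P j + k" by blast
  have "cheap_column \<eta> {0..<int j} (int j) k"
  proof -
    have "insert (int j) {0..<int j} = {0..<int (Suc j)}" by auto
    then show ?thesis using j by (simp add: cheap_column_def P_def)
  qed
  moreover have "cheap_column \<eta> {0..<int j} (-1) k"
  proof -
    have "card (patterns \<eta> (insert (-1) {0..<int j} \<times> {0..<int k})) \<le> P (Suc j)"
      unfolding P_def
    proof (rule card_patterns_le[where \<phi> = "\<lambda>v. (-1, 0) + v"])
      fix v w assume "agree \<eta> ({0..<int (Suc j)} \<times> {0..<int k}) ((-1, 0) + v) ((-1, 0) + w)"
      then show "agree \<eta> (insert (-1) {0..<int j} \<times> {0..<int k}) v w"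
        unfolding agree_shift
      proof (rule agree_mono)
        show "insert (-1) {0..<int j} \<times> {0..<int k}
            \<subseteq> (\<lambda>m. m + (-1, 0)) ` ({0..<int (Suc j)} \<times> {0..<int k})"
        proof
          fix m assume "m \<in> insert (-1) {0..<int j} \<times> {0..<int k}"
          then show "m \<in> (\<lambda>m. m + (-1, 0)) ` ({0..<int (Suc j)} \<times> {0..<int k})"
            by (intro image_eqI[of _ _ "m + (1, 0)"]) (auto simp: add.assoc zero_prod_def[symmetric])
        qed
      qed
    qed auto
    then show ?thesis using j by (simp add: cheap_column_def P_def)
  qed
  ultimately show ?thesis by blast
qed

definition subexp_squares :: "'a config \<Rightarrow> bool" where
  "subexp_squares \<eta> \<longleftrightarrow> (\<forall>\<delta>>0. \<forall>\<^sub>F s in sequentially.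
     real (card (patterns \<eta> ({0..<int s} \<times> {0..<int s}))) \<le> exp (\<delta> * real s))"

text \<open>
  The part of the hypothesis that the argument uses, for one of the two ways to order the
  coordinates: rectangles that are at least as high as wide, of unbounded height.
\<close>

definition few_tall_patterns :: "'a config \<Rightarrow> bool" where
  "few_tall_patterns \<eta> \<longleftrightarrow> (\<forall>K. \<exists>k\<ge>K. \<exists>n>0. n \<le> k \<and> card (patterns \<eta> ({0..<int n} \<times> {0..<int k})) \<le> n * k)"

text \<open>
  A column of height \<open>k\<close> has at most \<open>n * k \<le> k\<^sup>2\<close> patterns for arbitrarily large
  \<open>k\<close>, so covering a strip by such columns costs \<open>2 * ln k / k\<close> per cell in the
  exponent, which is as small as desired.
\<close>

lemma strip_growth:
  fixes \<eta> :: "'a::finite config"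
  assumes tt: "few_tall_patterns \<eta>" and \<delta>: "\<delta> > 0"
  shows "\<forall>\<^sub>F N in sequentially. real (card (patterns \<eta> ({0..<int J} \<times> {0..<int N}))) \<le> exp (\<delta> * real N)"
proof -
  have "(\<lambda>k. 2 * real J * (ln (real k) / real k)) \<longlonglongrightarrow> 0"
    using tendsto_mult_right_zero[OF lim_ln_over_n] by simp
  then have "\<forall>\<^sub>F k in sequentially. 2 * real J * (ln (real k) / real k) < \<delta> / 2"
    by (rule order_tendstoD) (use \<delta> in simp)
  then obtain K where K: "\<And>k. k \<ge> K \<Longrightarrow> 2 * real J * (ln (real k) / real k) < \<delta> / 2"
    by (auto simp: eventually_sequentially)
  obtain k n where kn: "k \<ge> Suc K" "n > 0" "n \<le> k" "card (patterns \<eta> ({0..<int n} \<times> {0..<int k})) \<le> n * k"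
    using tt unfolding few_tall_patterns_def by blast
  have k: "k > 0" "2 * real J * (ln (real k) / real k) < \<delta> / 2" using kn K[of k] by auto
  define c where "c = 2 * real J * ln (real k)"
  have c0: "c \<ge> 0" using k by (simp add: c_def)
  have ck: "c / real k \<le> \<delta> / 2" using k by (simp add: c_def)
  have col: "card (patterns \<eta> ({0} \<times> {0..<int k})) \<le> k ^ 2"
  proof -
    have "card (patterns \<eta> ({0} \<times> {0..<int k})) \<le> card (patterns \<eta> ({0..<int n} \<times> {0..<int k}))"
      by (rule card_patterns_mono) (use kn in auto)
    also have "\<dots> \<le> n * k" by (rule kn)
    also have "\<dots> \<le> k ^ 2" using kn by (simp add: power2_eq_square)
    finally show ?thesis .
  qed
  have bound: "real (card (patterns \<eta> ({0..<int J} \<times> {0..<int N}))) \<le> exp (c * (real N / real k + 1))" for N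
  proof -
    let ?I = "{0..<int J} \<times> {0..N div k}"
    have "card (patterns \<eta> ({0..<int J} \<times> {0..<int N})) \<le> card (patterns \<eta> ({0} \<times> {0..<int k})) ^ card ?I"
    proof (rule card_patterns_cover[where \<tau> = "\<lambda>(i, q). (i, int (q * k))"])
      show "{0..<int J} \<times> {0..<int N}
          \<subseteq> (\<Union>i\<in>?I. (\<lambda>m. m + (case i of (i, q) \<Rightarrow> (i, int (q * k)))) ` ({0} \<times> {0..<int k}))"
      proof
        fix m assume "m \<in> {0..<int J} \<times> {0..<int N}"
        then obtain i r where m: "m = (i, int r)" "i \<in> {0..<int J}" "r < N"
          by (cases m) (metis (no_types, lifting) SigmaD1 SigmaD2 atLeastLessThan_iff of_nat_less_iff zero_le_imp_eq_int)
        have "r div k \<le> N div k" using m by (intro div_le_mono) auto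
        moreover have "m = (0, int (r mod k)) + (i, int (r div k * k))"
          using m(1) by (simp flip: of_nat_add of_nat_mult)
        moreover have "r mod k < k" using k by simp
        ultimately show "m \<in> (\<Union>i\<in>?I. (\<lambda>m. m + (case i of (i, q) \<Rightarrow> (i, int (q * k)))) ` ({0} \<times> {0..<int k}))"
          using m(2) by (intro UN_I[of "(i, r div k)"] image_eqI[of _ _ "(0, int (r mod k))"]) auto
      qed
    qed auto
    also have "\<dots> \<le> (k ^ 2) ^ card ?I" by (rule power_mono[OF col]) simp
    also have "card ?I = J * (N div k + 1)" by (simp add: card_cartesian_product)
    finally have "real (card (patterns \<eta> ({0..<int J} \<times> {0..<int N}))) \<le> real ((k ^ 2) ^ (J * (N div k + 1)))"
      by (simp only: of_nat_le_iff)
    also have "\<dots> = real k ^ (2 * (J * (N div k + 1)))" by (simp only: of_nat_power power_mult)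
    also have "\<dots> = exp (ln (real k)) ^ (2 * (J * (N div k + 1)))" using k by simp
    also have "\<dots> = exp (c * (real (N div k) + 1))"
      unfolding exp_of_nat_mult[symmetric] by (simp add: c_def algebra_simps)
    also have "\<dots> \<le> exp (c * (real N / real k + 1))"
      using c0 by (simp add: of_nat_div_le_of_nat mult_left_mono)
    finally show ?thesis .
  qed
  show ?thesis
    unfolding eventually_sequentially
  proof (intro exI[of _ "nat \<lceil>2 * c / \<delta>\<rceil>"] allI impI)
    fix N assume "nat \<lceil>2 * c / \<delta>\<rceil> \<le> N"
    then have "2 * c / \<delta> \<le> real N" by linarith
    then have "c \<le> \<delta> / 2 * real N" using \<delta> by (simp add: field_simps)
    moreover have "c * (real N / real k) \<le> \<delta> / 2 * real N"
      using mult_right_mono[OF ck, of "real N"] by (simp add: field_simps)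
    ultimately have "c * (real N / real k) + c \<le> \<delta> * real N" by linarith
    then have "c * (real N / real k + 1) \<le> \<delta> * real N" by (simp only: distrib_left mult_1_right)
    then show "real (card (patterns \<eta> ({0..<int J} \<times> {0..<int N}))) \<le> exp (\<delta> * real N)"
      using bound[of N] by (meson exp_le_cancel_iff order_trans)
  qed
qed

lemma (in strip_rules) not_periodic_imp_subexp_squares:
  assumes tt: "few_tall_patterns \<eta>" and J: "J \<ge> 0" and nper: "\<exists>m. \<eta> (m + (0, L)) \<noteq> \<eta> m"
  shows "subexp_squares \<eta>"
  unfolding subexp_squares_def
proof (intro allI impI)
  fix \<delta> :: real assume \<delta>: "\<delta> > 0"
  define N where "N s = nat (2 * radius s + 1)" for s
  define K where "K = 6 * D + 2 * L + 3"
  have K: "K > 0" using D_nonneg L_pos by (simp add: K_def)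
  have N_le: "real (N s) \<le> real_of_int K * real s" if "s > 0" for s
  proof -
    have "int (N s) = 6 * D * int s + (2 * L + 1) + 2 * int s"
      using D_nonneg L_pos by (simp add: N_def radius_def algebra_simps)
    also have "\<dots> \<le> 6 * D * int s + (2 * L + 1) * int s + 2 * int s"
      using that L_pos mult_left_mono[of 1 "int s" "2 * L + 1"] by simp
    also have "\<dots> = K * int s" by (simp add: K_def algebra_simps)
    finally have "real_of_int (int (N s)) \<le> real_of_int (K * int s)" by (simp only: of_int_le_iff)
    then show ?thesis by simp
  qed
  have N_ge: "s \<le> N s" for s
    using D_nonneg L_pos by (simp add: N_def radius_def le_nat_iff)
  define \<delta>' where "\<delta>' = \<delta> / (2 * real_of_int K)"
  have \<delta>': "\<delta>' > 0" using \<delta> K by (simp add: \<delta>'_def)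
  obtain N0 where N0: "\<And>M. M \<ge> N0 \<Longrightarrow>
      real (card (patterns \<eta> ({0..<int (nat J)} \<times> {0..<int M}))) \<le> exp (\<delta>' * real M)"
    using strip_growth[OF tt \<delta>', of "nat J"] by (auto simp: eventually_sequentially)
  define c where "c = ln (3 * real (nat L))"
  have c: "3 * real (nat L) = exp c" using L_pos by (simp add: c_def)
  show "\<forall>\<^sub>F s in sequentially. real (card (patterns \<eta> ({0..<int s} \<times> {0..<int s}))) \<le> exp (\<delta> * real s)"
    unfolding eventually_sequentially
  proof (intro exI[of _ "max (Suc N0) (nat \<lceil>2 * c / \<delta>\<rceil>)"] allI impI)
    fix s assume s: "max (Suc N0) (nat \<lceil>2 * c / \<delta>\<rceil>) \<le> s"
    have "2 * c / \<delta> \<le> real s" using s by linarith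
    then have cs: "c \<le> \<delta> / 2 * real s" using \<delta> by (simp add: field_simps)
    have "card (patterns \<eta> ({0..<J} \<times> {- radius s..radius s})) \<le> card (patterns \<eta> ({0..<int (nat J)} \<times> {0..<int (N s)}))"
    proof (rule card_patterns_le[where \<phi> = "\<lambda>v. (0, - radius s) + v"])
      fix v w assume "agree \<eta> ({0..<int (nat J)} \<times> {0..<int (N s)}) ((0, - radius s) + v) ((0, - radius s) + w)"
      then show "agree \<eta> ({0..<J} \<times> {- radius s..radius s}) v w"
        unfolding agree_shift
      proof (rule agree_mono)
        show "{0..<J} \<times> {- radius s..radius s}
            \<subseteq> (\<lambda>m. m + (0, - radius s)) ` ({0..<int (nat J)} \<times> {0..<int (N s)})"
        proof
          fix m assume "m \<in> {0..<J} \<times> {- radius s..radius s}"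
          then show "m \<in> (\<lambda>m. m + (0, - radius s)) ` ({0..<int (nat J)} \<times> {0..<int (N s)})"
            by (intro image_eqI[of _ _ "m + (0, radius s)"]) (auto simp: add.assoc zero_prod_def[symmetric] N_def)
        qed
      qed
    qed auto
    also have "real \<dots> \<le> exp (\<delta>' * real (N s))"
      by (rule N0) (use N_ge[of s] s in simp)
    also have "\<dots> \<le> exp (\<delta> / 2 * real s)"
    proof -
      have "\<delta>' * real (N s) \<le> \<delta>' * (real_of_int K * real s)"
        using N_le[of s] s \<delta>' by (intro mult_left_mono) auto
      also have "\<dots> = \<delta> / 2 * real s" using K by (simp add: \<delta>'_def)
      finally show ?thesis by simp
    qed
    finally have strip: "real (card (patterns \<eta> ({0..<J} \<times> {- radius s..radius s}))) \<le> exp (\<delta> / 2 * real s)"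
      by simp
    have "real (card (patterns \<eta> ({0..<int s} \<times> {0..<int s})))
        \<le> real (3 * nat L * card (patterns \<eta> ({0..<J} \<times> {- radius s..radius s})))"
      using card_square_patterns_le[OF nper J, of s] by (simp only: of_nat_le_iff)
    also have "\<dots> = exp c * real (card (patterns \<eta> ({0..<J} \<times> {- radius s..radius s})))"
      using c by simp
    also have "\<dots> \<le> exp (\<delta> / 2 * real s) * exp (\<delta> / 2 * real s)"
      using strip cs by (intro mult_mono) auto
    also have "\<dots> = exp (\<delta> * real s)" by (simp add: exp_add[symmetric])
    finally show "real (card (patterns \<eta> ({0..<int s} \<times> {0..<int s}))) \<le> exp (\<delta> * real s)" .
  qed
qed

lemma few_tall_patterns_dichotomy:
  fixes \<eta> :: "'a::finite config"
  assumes "few_tall_patterns \<eta>"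
  shows "subexp_squares \<eta> \<or> (\<exists>L>0. \<forall>m. \<eta> (m + (0, L)) = \<eta> m)"
proof -
  obtain k n where "card (patterns \<eta> ({0..<int n} \<times> {0..<int k})) \<le> n * k"
    using assms unfolding few_tall_patterns_def by blast
  then obtain j where "cheap_column \<eta> {0..<int j} (int j) k" "cheap_column \<eta> {0..<int j} (-1) k"
    using exists_cheap_column by blast
  then obtain L D where rules: "strip_rules \<eta> (int j) L D" using cheap_columns_imp_strip_rules by blast
  interpret strip_rules \<eta> "int j" L D by (rule rules)
  show ?thesis using not_periodic_imp_subexp_squares[OF assms] L_pos by auto
qed

section \<open>Directional entropy\<close>

text \<open>
  Cylinder sets are open, so every finite window of a point of the orbit closure occurs in \<open>\<eta>\<close>.
\<close>

lemma orbit_closure_window: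
  assumes x: "x \<in> orbit_closure \<eta>" and F: "finite F"
  shows "\<exists>v. \<forall>m\<in>F. x m = \<eta> (m + v)"
proof -
  define U where "U = PiE (UNIV :: (int \<times> int) set) (\<lambda>m. if m \<in> F then {x m} else UNIV)"
  have "openin (product_topology (\<lambda>_. discrete_topology UNIV) UNIV) U"
    unfolding U_def openin_PiE_gen
    by (intro disjI2 conjI) (auto intro: finite_subset[OF _ F])
  moreover have "x \<in> U" by (auto simp: U_def)
  ultimately obtain y where "y \<in> {translate v \<eta> | v. True}" "y \<in> U"
    using x unfolding orbit_closure_def in_closure_of by blast
  then obtain v where y: "y = translate v \<eta>" "y \<in> U" by blast
  have "x m = y m" if "m \<in> F" for m
  proof -
    have "y m \<in> (if m \<in> F then {x m} else UNIV)" using y(2) unfolding U_def by (rule PiE_mem) simp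
    then show ?thesis using that by simp
  qed
  then show ?thesis using y(1) unfolding translate_def by blast
qed

lemma translate_in_orbit_closure: "translate v \<eta> \<in> orbit_closure \<eta>"
proof -
  have "{translate n \<eta> | n. True} \<subseteq> orbit_closure \<eta>"
    unfolding orbit_closure_def by (rule closure_of_subset) (simp add: PiE_UNIV_domain)
  then show ?thesis by blast
qed

lemma rho_less:
  assumes agree: "\<And>m. norm (pt m) \<le> r \<Longrightarrow> x m = y m"
  shows "rho x y < 2 powr (- r)"
proof (cases "x = y")
  case False
  \<comment> \<open>The least distance exists because squared norms of lattice points are natural numbers.\<close>
  define d where "d m = nat ((fst m)\<^sup>2 + (snd m)\<^sup>2)" for m :: "int \<times> int"
  have norm: "norm (pt m) = sqrt (real (d m))" for m
    by (simp add: pt_def norm_Pair d_def)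
  obtain m where "x m \<noteq> y m" using False by blast
  then obtain m where m: "x m \<noteq> y m" "\<And>n. x n \<noteq> y n \<Longrightarrow> d m \<le> d n"
    using ex_has_least_nat[of "\<lambda>m. x m \<noteq> y m" m d] by blast
  have "(LEAST r. \<exists>m. x m \<noteq> y m \<and> r = norm (pt m)) = norm (pt m)"
  proof (rule Least_equality)
    show "\<exists>n. x n \<noteq> y n \<and> norm (pt m) = norm (pt n)" using m(1) by blast
    show "norm (pt m) \<le> r" if "\<exists>n. x n \<noteq> y n \<and> r = norm (pt n)" for r
      using that m(2) norm by auto
  qed
  moreover have "norm (pt m) > r" using agree[of m] m(1) by force
  ultimately show ?thesis using False by (simp add: rho_def)
qed (simp add: rho_def)

text \<open>
  Points that agree within distance \<open>- log 2 \<epsilon>\<close> of every lattice point of \<open>E\<close> are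
  \<open>\<epsilon>\<close>-close along \<open>E\<close>, so one representative of each pattern on a large enough box
  suffices.
\<close>

lemma span_number_le:
  fixes \<eta> :: "'a::finite config"
  assumes W: "\<And>n. pt n \<in> E \<Longrightarrow> norm (pt n) \<le> W" and \<epsilon>: "\<epsilon> > 0"
    and b: "W + \<bar>log 2 \<epsilon>\<bar> \<le> real_of_int b"
  shows "span_number \<eta> E \<epsilon> \<le> card (patterns \<eta> ({-b..b} \<times> {-b..b}))"
proof -
  let ?B = "{-b..b} \<times> {-b..b}"
  let ?X = "orbit_closure \<eta>"
  define f where "f x = restrict x ?B" for x :: "'a config"
  have sub: "f ` ?X \<subseteq> patterns \<eta> ?B"
  proof
    fix g assume "g \<in> f ` ?X"
    then obtain x where x: "x \<in> ?X" "g = f x" by blast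
    obtain v where v: "\<forall>m\<in>?B. x m = \<eta> (m + v)"
      using orbit_closure_window[OF x(1), of ?B] finite_cartesian_product[OF finite_atLeastAtMost_int finite_atLeastAtMost_int] by blast
    have "g = window \<eta> ?B v"
      unfolding x(2) f_def window_def translate_def by (rule restrict_ext) (use v in blast)
    then show "g \<in> patterns \<eta> ?B" by (simp add: patterns_def)
  qed
  have finB: "finite (patterns \<eta> ?B)" by (rule finite_patterns) auto
  define Y where "Y = inv_into ?X f ` f ` ?X"
  have "spanning \<eta> E \<epsilon> Y"
    unfolding spanning_def
  proof (intro conjI ballI)
    show "Y \<subseteq> ?X" unfolding Y_def by (auto intro: inv_into_into)
    fix x assume x: "x \<in> ?X"
    define y where "y = inv_into ?X f (f x)"
    have "f y = f x" unfolding y_def using f_inv_into_f[of "f x" f ?X] x by blast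
    then have eq: "y m = x m" if "m \<in> ?B" for m
      using that unfolding f_def by (metis restrict_apply')
    have "rho (translate n x) (translate n y) < \<epsilon>" if n: "pt n \<in> E" for n
    proof -
      have "rho (translate n x) (translate n y) < 2 powr (- (- log 2 \<epsilon>))"
      proof (rule rho_less)
        fix m assume m: "norm (pt m) \<le> - log 2 \<epsilon>"
        have "norm (pt (m + n)) \<le> norm (pt m) + norm (pt n)"
          using norm_triangle_ineq[of "pt m" "pt n"] by (simp add: pt_def)
        also have "\<dots> \<le> real_of_int b" using m W[OF n] b by linarith
        finally have "norm (fst (pt (m + n))) \<le> real_of_int b" "norm (snd (pt (m + n))) \<le> real_of_int b"
          using norm_fst_le[of "fst (pt (m + n))" "snd (pt (m + n))"]
            norm_snd_le[of "snd (pt (m + n))" "fst (pt (m + n))"] by auto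
        then have "\<bar>real_of_int (fst (m + n))\<bar> \<le> real_of_int b" "\<bar>real_of_int (snd (m + n))\<bar> \<le> real_of_int b"
          by (simp_all add: pt_def)
        then have "\<bar>fst (m + n)\<bar> \<le> b" "\<bar>snd (m + n)\<bar> \<le> b" by linarith+
        then have "m + n \<in> ?B" by (cases "m + n") auto
        then show "translate n x m = translate n y m" using eq by (simp add: translate_def)
      qed
      also have "\<dots> = \<epsilon>" using \<epsilon> by simp
      finally show ?thesis .
    qed
    then show "\<exists>y\<in>Y. \<forall>n. pt n \<in> E \<longrightarrow> rho (translate n x) (translate n y) < \<epsilon>"
      using x by (intro bexI[of _ y]) (auto simp: Y_def y_def)
  qed
  moreover have finf: "finite (f ` ?X)" using sub finB by (rule finite_subset)
  moreover have "finite Y" unfolding Y_def using finf by blast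
  ultimately have "span_number \<eta> E \<epsilon> \<le> card Y"
    unfolding span_number_def by (intro Least_le) blast
  also have "\<dots> \<le> card (f ` ?X)" unfolding Y_def by (rule card_image_le[OF finf])
  also have "\<dots> \<le> card (patterns \<eta> ?B)" by (rule card_mono[OF finB sub])
  finally show ?thesis .
qed

lemma norm_thicken_segment:
  fixes u :: "real \<times> real"
  assumes "norm u = 1" "s \<ge> 0" "v \<in> thicken (closed_segment 0 (s *\<^sub>R u)) t"
  shows "norm v \<le> s + t"
proof -
  obtain w where w: "w \<in> closed_segment 0 (s *\<^sub>R u)" "norm (v - w) < t"
    using assms(3) by (auto simp: thicken_def)
  obtain q where q: "w = q *\<^sub>R (s *\<^sub>R u)" "0 \<le> q" "q \<le> 1"
    using w(1) by (auto simp: closed_segment_def)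
  have "norm w \<le> s" using q assms by (simp add: mult_left_le_one_le)
  then show ?thesis using w(2) norm_triangle_sub[of v w] by linarith
qed

text \<open>
  The thickened segment of length \<open>s\<close>, and the cells near it that matter for a given
  \<open>\<epsilon>\<close>, lie in a square whose side is at most \<open>3 * s\<close> for large \<open>s\<close>,
  whatever the direction.
\<close>

lemma subexp_squares_imp_dir_entropy_zero:
  fixes \<eta> :: "'a::finite config" and u :: "real \<times> real"
  assumes sub: "subexp_squares \<eta>" and u: "norm u = 1"
  shows "dir_entropy \<eta> u = 0"
proof -
  define h where "h \<epsilon> t s = ereal (ln (real (span_number \<eta> (thicken (closed_segment 0 (s *\<^sub>R u)) t) \<epsilon>)) / s)"
    for \<epsilon> t s
  have nonneg: "\<forall>\<^sub>F s in at_top. 0 \<le> h \<epsilon> t s" for \<epsilon> t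
    using eventually_gt_at_top[of 0]
  proof eventually_elim
    case (elim s)
    have "0 \<le> ln (real N)" for N by (cases "N = 0") auto
    then show ?case using elim by (simp add: h_def)
  qed
  have small: "\<forall>\<^sub>F s in at_top. h \<epsilon> t s \<le> ereal \<delta>" if pos: "\<epsilon> > 0" "t > 0" "\<delta> > 0" for \<epsilon> t \<delta>
  proof -
    define C where "C = t + \<bar>log 2 \<epsilon>\<bar>"
    have C: "C > 0" using pos by (simp add: C_def)
    obtain S where S: "\<And>s. s \<ge> S \<Longrightarrow>
        real (card (patterns \<eta> ({0..<int s} \<times> {0..<int s}))) \<le> exp (\<delta> / 3 * real s)"
      using sub pos(3) unfolding subexp_squares_def eventually_sequentially
      by (metis divide_pos_pos zero_less_numeral)
    show ?thesis
      using eventually_gt_at_top[of "max (real S) (2 * C + 3)"]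
    proof eventually_elim
      case (elim s)
      have s: "s > real S" "s > 2 * C + 3" "s > 0" using elim C by auto
      define E where "E = thicken (closed_segment 0 (s *\<^sub>R u)) t"
      define b where "b = \<lceil>s + C\<rceil>"
      define M where "M = nat (2 * b + 1)"
      have b: "s + C \<le> real_of_int b" "real_of_int b < s + C + 1" unfolding b_def by linarith+
      have "b > 0" using b s C by linarith
      then have M: "int M = 2 * b + 1" by (simp add: M_def)
      then have M': "real M = 2 * real_of_int b + 1" by (metis of_int_add of_int_mult of_int_numeral of_int_of_nat_eq of_int_1)
      have "real M \<ge> real S" using M' b s C by linarith
      then have MS: "M \<ge> S" by simp
      have M3: "real M \<le> 3 * s" using M' b s by linarith
      have "span_number \<eta> E \<epsilon> \<le> card (patterns \<eta> ({-b..b} \<times> {-b..b}))"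
      proof (rule span_number_le[where W = "s + t"])
        show "norm (pt n) \<le> s + t" if "pt n \<in> E" for n
          using norm_thicken_segment[OF u _ that[unfolded E_def]] s by simp
        show "s + t + \<bar>log 2 \<epsilon>\<bar> \<le> real_of_int b" using b by (simp add: C_def)
      qed (rule pos(1))
      also have "\<dots> \<le> card (patterns \<eta> ({0..<int M} \<times> {0..<int M}))"
      proof (rule card_patterns_le[where \<phi> = "\<lambda>v. (-b, -b) + v"])
        fix v w assume "agree \<eta> ({0..<int M} \<times> {0..<int M}) ((-b, -b) + v) ((-b, -b) + w)"
        then show "agree \<eta> ({-b..b} \<times> {-b..b}) v w"
          unfolding agree_shift
        proof (rule agree_mono)
          show "{-b..b} \<times> {-b..b} \<subseteq> (\<lambda>m. m + (-b, -b)) ` ({0..<int M} \<times> {0..<int M})"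
          proof
            fix m assume "m \<in> {-b..b} \<times> {-b..b}"
            then show "m \<in> (\<lambda>m. m + (-b, -b)) ` ({0..<int M} \<times> {0..<int M})"
              by (intro image_eqI[of _ _ "m + (b, b)"]) (auto simp: add.assoc zero_prod_def[symmetric] M)
          qed
        qed
      qed auto
      finally have "real (span_number \<eta> E \<epsilon>) \<le> exp (\<delta> / 3 * real M)"
        using S[OF MS] by (meson of_nat_le_iff order_trans)
      also have "\<dots> \<le> exp (\<delta> * s)"
        using M3 pos(3) mult_left_mono[of "real M" "3 * s" "\<delta> / 3"] by simp
      finally have le: "real (span_number \<eta> E \<epsilon>) \<le> exp (\<delta> * s)" .
      have "ln (real (span_number \<eta> E \<epsilon>)) \<le> \<delta> * s"
      proof (cases "span_number \<eta> E \<epsilon> = 0")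
        case True
        then show ?thesis using pos s by simp
      next
        case False
        then show ?thesis using le by (metis ln_exp ln_le_cancel_iff exp_gt_zero of_nat_0_less_iff neq0_conv)
      qed
      then show ?case using s by (simp add: h_def E_def divide_le_eq)
    qed
  qed
  have lim: "Limsup at_top (h \<epsilon> t) = 0" if "\<epsilon> > 0" "t > 0" for \<epsilon> t
  proof (rule antisym)
    show "0 \<le> Limsup at_top (h \<epsilon> t)" by (rule le_Limsup[OF _ nonneg]) simp
    show "Limsup at_top (h \<epsilon> t) \<le> 0"
    proof (rule ereal_le_epsilon2)
      fix \<delta> :: real assume "\<delta> > 0"
      then show "Limsup at_top (h \<epsilon> t) \<le> 0 + ereal \<delta>"
        using Limsup_bounded[OF small[OF that]] by simp
    qed
  qed
  have sup: "(SUP t\<in>{0<..}. Limsup at_top (h \<epsilon> t)) = 0" if "\<epsilon> > 0" for \<epsilon>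
  proof -
    have "(\<lambda>t. Limsup at_top (h \<epsilon> t)) ` {0<..} = {0}"
      using lim[OF that] by (force intro: image_eqI[of _ _ 1])
    then show ?thesis by simp
  qed
  have "((\<lambda>\<epsilon>. SUP t\<in>{0<..}. Limsup at_top (h \<epsilon> t)) \<longlongrightarrow> 0) (at_right 0)"
    by (rule tendsto_eventually) (use sup in \<open>simp add: eventually_at_filter\<close>)
  then have "Lim (at_right 0) (\<lambda>\<epsilon>. SUP t\<in>{0<..}. Limsup at_top (h \<epsilon> t)) = 0"
    by (intro tendsto_Lim) auto
  then show ?thesis unfolding dir_entropy_def h_def[abs_def] .
qed

lemma subexp_squares_if_finite_orbit_closure:
  assumes "finite (orbit_closure \<eta>)"
  shows "subexp_squares \<eta>"
  unfolding subexp_squares_def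
proof (intro allI impI)
  fix \<delta> :: real assume \<delta>: "\<delta> > 0"
  have bound: "card (patterns \<eta> S) \<le> card (orbit_closure \<eta>)" for S
  proof (rule card_patterns_le_codes[where R = "\<lambda>v c. c = translate v \<eta>"])
    show "\<exists>c\<in>orbit_closure \<eta>. c = translate v \<eta>" for v
      using translate_in_orbit_closure by blast
    show "agree \<eta> S v w" if "c = translate v \<eta>" "c = translate w \<eta>" for v w c
      using that unfolding agree_def translate_def by metis
  qed (rule assms)
  define c where "c = ln (real (card (orbit_closure \<eta>)))"
  have "card (orbit_closure \<eta>) \<noteq> 0"
    using assms translate_in_orbit_closure by (metis card_0_eq empty_iff)
  then have c: "real (card (orbit_closure \<eta>)) = exp c" by (simp add: c_def)
  show "\<forall>\<^sub>F s in sequentially. real (card (patterns \<eta> ({0..<int s} \<times> {0..<int s}))) \<le> exp (\<delta> * real s)"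
    unfolding eventually_sequentially
  proof (intro exI[of _ "nat \<lceil>c / \<delta>\<rceil>"] allI impI)
    fix s assume "nat \<lceil>c / \<delta>\<rceil> \<le> s"
    then have "c / \<delta> \<le> real s" by linarith
    then have "exp c \<le> exp (\<delta> * real s)" using \<delta> by (simp add: field_simps)
    moreover have "real (card (patterns \<eta> ({0..<int s} \<times> {0..<int s}))) \<le> exp c"
      using bound[of "{0..<int s} \<times> {0..<int s}"] c by (metis of_nat_le_iff)
    ultimately show "real (card (patterns \<eta> ({0..<int s} \<times> {0..<int s}))) \<le> exp (\<delta> * real s)" by linarith
  qed
qed

section \<open>Periodic configurations\<close>

lemma orbit_closure_periodic:
  assumes per: "\<And>m. \<eta> (m + p) = \<eta> m" and x: "x \<in> orbit_closure \<eta>"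
  shows "x (m + (q * fst p, q * snd p)) = x m"
proof -
  have step: "x (m + p) = x m" for m
  proof -
    obtain v where v: "\<forall>n\<in>{m, m + p}. x n = \<eta> (n + v)"
      using orbit_closure_window[OF x, of "{m, m + p}"] by blast
    have "x (m + p) = \<eta> (m + p + v)" "x m = \<eta> (m + v)" using v by blast+
    moreover have "m + p + v = m + v + p" by (simp add: algebra_simps)
    ultimately show ?thesis using per[of "m + v"] by (simp only:)
  qed
  have nat: "x (m + (int n * fst p, int n * snd p)) = x m" for n m
  proof (induction n)
    case 0
    then show ?case by (simp add: zero_prod_def[symmetric])
  next
    case (Suc n)
    have "m + (int (Suc n) * fst p, int (Suc n) * snd p) = m + (int n * fst p, int n * snd p) + p"
      by (cases p) (simp add: algebra_simps)
    then show ?case using step[of "m + (int n * fst p, int n * snd p)"] Suc by (simp only:)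
  qed
  show ?thesis
  proof (cases "q \<ge> 0")
    case True
    then show ?thesis using nat[of m "nat q"] by simp
  next
    case False
    define m' where "m' = m + (q * fst p, q * snd p)"
    have "m = m' + (int (nat (- q)) * fst p, int (nat (- q)) * snd p)"
      using False by (simp add: m'_def zero_prod_def[symmetric] add.assoc)
    then have "x m = x m'" using nat[of m' "nat (- q)"] by (simp only:)
    then show ?thesis by (simp only: m'_def)
  qed
qed

lemma pt_add: "pt (m + n) = pt m + pt n"
  by (simp add: pt_def)

lemma pt_scale: "pt (q * fst p, q * snd p) = of_int q *\<^sub>R pt p"
  by (simp add: pt_def)

lemma pt_eq_0: "pt p = 0 \<longleftrightarrow> p = 0"
  by (simp add: pt_def prod_eq_iff)

lemma span_scaled: "c \<noteq> 0 \<Longrightarrow> span {c *\<^sub>R v} = span {v}" for v :: "'b::real_vector"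
proof (rule span_eq[THEN iffD2], intro conjI)
  assume "c \<noteq> 0"
  then have "v = inverse c *\<^sub>R (c *\<^sub>R v)" by simp
  then show "{v} \<subseteq> span {c *\<^sub>R v}" using span_scale[OF span_base[of "c *\<^sub>R v" "{c *\<^sub>R v}"], of "inverse c"] by simp
qed (simp add: span_scale span_base)

text \<open>
  Adding multiples of the period to a lattice point moves it across the line, so every point has
  a translate at distance less than the length of the period.
\<close>

lemma expansive_if_not_parallel_to_period:
  assumes per: "\<And>m. \<eta> (m + p) = \<eta> m" and p: "p \<noteq> 0" and v: "v \<noteq> 0"
    and np: "span {v} \<noteq> span {pt p}"
  shows "expansive \<eta> (span {v})"
proof -
  obtain a b where ab: "v = (a, b)" by (cases v)
  obtain p1 p2 where pp: "pt p = (p1, p2)" by (cases "pt p")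
  define d where "d = a * p2 - b * p1"
  have pt0: "pt p \<noteq> 0" using p pt_eq_0 by blast
  have d: "d \<noteq> 0"
  proof
    assume d0: "d = 0"
    have "\<exists>c. pt p = c *\<^sub>R v"
    proof (cases "a = 0")
      case True
      then have "b \<noteq> 0" "p1 = 0" using v ab d0 by (auto simp: d_def zero_prod_def)
      then show ?thesis using True by (intro exI[of _ "p2 / b"]) (simp add: ab pp)
    next
      case False
      then show ?thesis using d0 by (intro exI[of _ "p1 / a"]) (simp add: ab pp d_def field_simps)
    qed
    then obtain c where c: "pt p = c *\<^sub>R v" by blast
    then have "c \<noteq> 0" using pt0 by auto
    then show False using np c span_scaled by metis
  qed
  have near: "\<exists>q. infdist (pt (n + (q * fst p, q * snd p))) (span {v}) < norm (pt p)" for n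
  proof -
    obtain z1 z2 where z: "pt n = (z1, z2)" by (cases "pt n")
    \<comment> \<open>Coordinates of the lattice point in the basis \<open>v, pt p\<close>, by Cramer's rule.\<close>
    define \<beta> where "\<beta> = (a * z2 - b * z1) / d"
    define \<alpha> where "\<alpha> = (z1 * p2 - z2 * p1) / d"
    have "\<alpha> * a + \<beta> * p1 = z1 * d / d"
      unfolding \<alpha>_def \<beta>_def times_divide_eq_left add_divide_distrib[symmetric]
      by (rule arg_cong[where f = "\<lambda>x. x / d"]) (simp add: d_def algebra_simps)
    moreover have "\<alpha> * b + \<beta> * p2 = z2 * d / d"
      unfolding \<alpha>_def \<beta>_def times_divide_eq_left add_divide_distrib[symmetric]
      by (rule arg_cong[where f = "\<lambda>x. x / d"]) (simp add: d_def algebra_simps)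
    ultimately have n: "pt n = \<alpha> *\<^sub>R v + \<beta> *\<^sub>R pt p" using d by (simp add: z ab pp)
    define q where "q = - \<lfloor>\<beta>\<rfloor>"
    have "pt (n + (q * fst p, q * snd p)) = \<alpha> *\<^sub>R v + (\<beta> + of_int q) *\<^sub>R pt p"
      by (simp add: pt_add pt_scale n scaleR_add_left)
    then have "dist (pt (n + (q * fst p, q * snd p))) (\<alpha> *\<^sub>R v) = \<bar>\<beta> + of_int q\<bar> * norm (pt p)"
      by (simp add: dist_norm)
    also have "\<dots> < 1 * norm (pt p)"
    proof (rule mult_strict_right_mono)
      show "\<bar>\<beta> + real_of_int q\<bar> < 1" unfolding q_def by linarith
    qed (use pt0 in simp)
    finally have "dist (pt (n + (q * fst p, q * snd p))) (\<alpha> *\<^sub>R v) < norm (pt p)" by simp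
    moreover have "\<alpha> *\<^sub>R v \<in> span {v}" by (intro span_scale span_base) simp
    ultimately show ?thesis using infdist_le le_less_trans by blast
  qed
  show ?thesis
    unfolding expansive_def
  proof (intro exI[of _ "norm (pt p)"] conjI ballI impI)
    show "0 < norm (pt p)" using pt0 by simp
    fix x y assume xy: "x \<in> orbit_closure \<eta>" "y \<in> orbit_closure \<eta>"
      "\<forall>n. infdist (pt n) (span {v}) < norm (pt p) \<longrightarrow> x n = y n"
    show "x = y"
    proof
      fix n
      obtain q where "infdist (pt (n + (q * fst p, q * snd p))) (span {v}) < norm (pt p)"
        using near by blast
      then have "x (n + (q * fst p, q * snd p)) = y (n + (q * fst p, q * snd p))" using xy(3) by blast
      then show "x n = y n"
        using orbit_closure_periodic[where \<eta> = \<eta> and p = p, OF per xy(1), of n q]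
          orbit_closure_periodic[where \<eta> = \<eta> and p = p, OF per xy(2), of n q] by simp
    qed
  qed
qed

text \<open>
  Modulo the period, a neighbourhood of the line along the period contains only finitely many lattice
  points. If the line is expansive, they determine the point of the orbit closure.
\<close>

lemma finite_orbit_closure_if_period_expansive:
  fixes \<eta> :: "'a::finite config"
  assumes per: "\<And>m. \<eta> (m + p) = \<eta> m" and ex: "expansive \<eta> (span {pt p})"
  shows "finite (orbit_closure \<eta>)"
proof -
  obtain r where r: "r > 0" "\<And>x y. x \<in> orbit_closure \<eta> \<Longrightarrow> y \<in> orbit_closure \<eta> \<Longrightarrow>
      (\<And>n. infdist (pt n) (span {pt p}) < r \<Longrightarrow> x n = y n) \<Longrightarrow> x = y"
    using ex unfolding expansive_def by blast
  define b where "b = \<lceil>r + norm (pt p)\<rceil>"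
  define F where "F = {-b..b} \<times> {-b..b}"
  have F: "n \<in> F" if "norm (pt n) \<le> r + norm (pt p)" for n
  proof -
    have "\<bar>real_of_int (fst n)\<bar> \<le> r + norm (pt p)" "\<bar>real_of_int (snd n)\<bar> \<le> r + norm (pt p)"
      using that norm_fst_le[of "fst (pt n)" "snd (pt n)"] norm_snd_le[of "snd (pt n)" "fst (pt n)"]
      by (simp_all add: pt_def)
    then have "\<bar>fst n\<bar> \<le> b" "\<bar>snd n\<bar> \<le> b" unfolding b_def by linarith+
    then show ?thesis by (cases n) (auto simp: F_def)
  qed
  have inj: "inj_on (\<lambda>x. restrict x F) (orbit_closure \<eta>)"
  proof (rule inj_onI)
    fix x y assume xy: "x \<in> orbit_closure \<eta>" "y \<in> orbit_closure \<eta>" "restrict x F = restrict y F"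
    show "x = y"
    proof (rule r(2)[OF xy(1,2)])
      fix n assume "infdist (pt n) (span {pt p}) < r"
      moreover have ne: "span {pt p} \<noteq> {}" using span_zero by blast
      ultimately have "\<exists>w\<in>span {pt p}. dist (pt n) w < r"
        unfolding infdist_notempty[OF ne] by (meson cINF_greatest ne not_le)
      then obtain c where c: "dist (pt n) (c *\<^sub>R pt p) < r"
        unfolding span_singleton by blast
      define q where "q = - \<lfloor>c\<rfloor>"
      define n' where "n' = n + (q * fst p, q * snd p)"
      have "pt n' = (pt n - c *\<^sub>R pt p) + (c + of_int q) *\<^sub>R pt p"
        by (simp add: n'_def pt_add pt_scale scaleR_add_left)
      then have "norm (pt n') \<le> norm (pt n - c *\<^sub>R pt p) + norm ((c + of_int q) *\<^sub>R pt p)"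
        by (metis norm_triangle_ineq)
      also have "\<dots> \<le> r + 1 * norm (pt p)"
      proof (rule add_mono)
        show "norm (pt n - c *\<^sub>R pt p) \<le> r" using c by (simp add: dist_norm)
        have "\<bar>c + of_int q\<bar> \<le> 1" unfolding q_def by linarith
        then show "norm ((c + of_int q) *\<^sub>R pt p) \<le> 1 * norm (pt p)"
          unfolding norm_scaleR by (rule mult_right_mono) simp
      qed
      finally have "n' \<in> F" by (intro F) simp
      then have "x n' = y n'" using xy(3) by (metis restrict_apply')
      then show "x n = y n"
        using orbit_closure_periodic[where \<eta> = \<eta> and p = p, OF per xy(1), of n q]
          orbit_closure_periodic[where \<eta> = \<eta> and p = p, OF per xy(2), of n q] by (simp add: n'_def)
    qed
  qed
  have "(\<lambda>x. restrict x F) ` orbit_closure \<eta> \<subseteq> PiE F (\<lambda>_. UNIV)" by auto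
  moreover have "finite (PiE F (\<lambda>_. UNIV :: 'a set))"
    by (intro finite_PiE) (auto simp: F_def)
  ultimately show ?thesis using inj finite_imageD finite_subset by blast
qed

lemma periodic_dichotomy:
  fixes \<eta> :: "'a::finite config"
  assumes per: "\<And>m. \<eta> (m + p) = \<eta> m" and p: "p \<noteq> 0"
  shows "subexp_squares \<eta> \<or> nonexpansive_directions \<eta> = {span {pt p}} \<and> periodic_in_direction \<eta> (pt p)"
proof (cases "expansive \<eta> (span {pt p})")
  case True
  then show ?thesis
    using finite_orbit_closure_if_period_expansive[where \<eta> = \<eta> and p = p, OF per] subexp_squares_if_finite_orbit_closure by blast
next
  case False
  have "nonexpansive_directions \<eta> = {span {pt p}}"
  proof
    show "nonexpansive_directions \<eta> \<subseteq> {span {pt p}}"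
      using expansive_if_not_parallel_to_period[where \<eta> = \<eta> and p = p, OF per p] unfolding nonexpansive_directions_def by blast
    show "{span {pt p}} \<subseteq> nonexpansive_directions \<eta>"
      using False p pt_eq_0 unfolding nonexpansive_directions_def by blast
  qed
  moreover have "periodic_in_direction \<eta> (pt p)"
    unfolding periodic_in_direction_def
  proof (intro exI[of _ p] conjI allI)
    show "\<eta> (p + n) = \<eta> n" for n using per[of n] by (simp only: add.commute)
  qed (use p in \<open>simp_all add: span_base\<close>)
  ultimately show ?thesis by blast
qed

section \<open>Exchanging the coordinates\<close>

lemma card_patterns_swap:
  fixes \<eta> :: "'a::finite config"
  assumes "finite A" "finite B"
  shows "card (patterns (\<eta> \<circ> prod.swap) (A \<times> B)) \<le> card (patterns \<eta> (B \<times> A))"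
proof (rule card_patterns_le[where \<phi> = prod.swap])
  fix v w assume *: "agree \<eta> (B \<times> A) (prod.swap v) (prod.swap w)"
  have swap_add: "prod.swap (m + u) = prod.swap m + prod.swap u" for m u :: "int \<times> int"
    by (cases m, cases u) simp
  show "agree (\<eta> \<circ> prod.swap) (A \<times> B) v w"
    unfolding agree_def
  proof
    fix m assume "m \<in> A \<times> B"
    then have "prod.swap m \<in> B \<times> A" by (cases m) simp
    with * have "\<eta> (prod.swap m + prod.swap v) = \<eta> (prod.swap m + prod.swap w)"
      unfolding agree_def by (rule bspec)
    then show "(\<eta> \<circ> prod.swap) (m + v) = (\<eta> \<circ> prod.swap) (m + w)" by (simp add: swap_add)
  qed
qed (use assms in simp)

lemma subexp_squares_swap:
  fixes \<eta> :: "'a::finite config"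
  assumes "subexp_squares (\<eta> \<circ> prod.swap)"
  shows "subexp_squares \<eta>"
  unfolding subexp_squares_def
proof (intro allI impI)
  fix \<delta> :: real assume "\<delta> > 0"
  then have ev: "\<forall>\<^sub>F s in sequentially.
      real (card (patterns (\<eta> \<circ> prod.swap) ({0..<int s} \<times> {0..<int s}))) \<le> exp (\<delta> * real s)"
    using assms unfolding subexp_squares_def by blast
  have swap2: "(\<eta> \<circ> prod.swap) \<circ> prod.swap = \<eta>" by (auto simp: fun_eq_iff)
  show "\<forall>\<^sub>F s in sequentially. real (card (patterns \<eta> ({0..<int s} \<times> {0..<int s}))) \<le> exp (\<delta> * real s)"
    using ev
  proof eventually_elim
    case (elim s)
    have "card (patterns \<eta> ({0..<int s} \<times> {0..<int s}))
        \<le> card (patterns (\<eta> \<circ> prod.swap) ({0..<int s} \<times> {0..<int s}))"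
      using card_patterns_swap[of "{0..<int s}" "{0..<int s}" "\<eta> \<circ> prod.swap"] swap2 by simp
    then show ?case using elim by linarith
  qed
qed

text \<open>
  Only finitely many distinct pairs have \<open>n \<le> k < K\<close>.
\<close>

lemma few_tall_patternsI:
  assumes inj: "inj (\<lambda>i::nat. (n i, k i))" and I: "infinite I"
    and i: "\<And>i. i \<in> I \<Longrightarrow> 0 < n i \<and> n i \<le> k i \<and> card (patterns \<eta> ({0..<int (n i)} \<times> {0..<int (k i)})) \<le> n i * k i"
  shows "few_tall_patterns \<eta>"
  unfolding few_tall_patterns_def
proof
  fix K
  have "\<exists>j\<in>I. K \<le> k j"
  proof (rule ccontr)
    assume neg: "\<not> ?thesis"
    have "(\<lambda>i. (n i, k i)) ` I \<subseteq> {..K} \<times> {..K}"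
    proof
      fix z assume "z \<in> (\<lambda>i. (n i, k i)) ` I"
      then obtain j where j: "j \<in> I" "z = (n j, k j)" by blast
      then have "k j < K" using neg by (meson not_le)
      then show "z \<in> {..K} \<times> {..K}" using j i[OF j(1)] by simp
    qed
    then have "finite ((\<lambda>i. (n i, k i)) ` I)" by (rule finite_subset) simp
    then show False using I inj by (metis finite_imageD inj_on_subset subset_UNIV)
  qed
  then show "\<exists>k\<ge>K. \<exists>n>0. n \<le> k \<and> card (patterns \<eta> ({0..<int n} \<times> {0..<int k})) \<le> n * k"
    using i by blast
qed

lemma span_axis_period:
  "L > 0 \<Longrightarrow> span {pt (0, L)} = span {(0, 1)}" "L > 0 \<Longrightarrow> span {pt (L, 0)} = span {(1, 0)}"
  using span_scaled[of "of_int L" "(0, 1) :: real \<times> real"] span_scaled[of "of_int L" "(1, 0) :: real \<times> real"]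
  by (simp_all add: pt_def)

section \<open>Entropy zero or an axis-parallel period\<close>

theorem theorem1p2:
  fixes \<eta> :: "int \<times> int \<Rightarrow> 'a::finite" and n k :: "nat \<Rightarrow> nat"
  assumes "inj (\<lambda>i. (n i, k i))"
    and "\<And>i. n i > 0" and "\<And>i. k i > 0"
    and "\<And>i. rect_complexity \<eta> (n i) (k i) \<le> n i * k i"
  shows "(\<forall>u::real \<times> real. norm u = 1 \<longrightarrow> dir_entropy \<eta> u = 0) \<or>
    (\<exists>v\<in>{(1, 0), (0, 1)}. nonexpansive_directions \<eta> = {span {v}} \<and> periodic_in_direction \<eta> v)"
proof -
  have P: "card (patterns \<eta> ({0..<int (n i)} \<times> {0..<int (k i)})) \<le> n i * k i" for i
    using assms(4) unfolding rect_complexity_eq .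
  have "subexp_squares \<eta> \<or> (\<exists>L>0. (\<forall>m. \<eta> (m + (0, L)) = \<eta> m) \<or> (\<forall>m. \<eta> (m + (L, 0)) = \<eta> m))"
  proof (cases "infinite {i. n i \<le> k i}")
    case True
    have "few_tall_patterns \<eta>"
      by (rule few_tall_patternsI[OF assms(1) True]) (use assms(2) P in auto)
    then show ?thesis using few_tall_patterns_dichotomy by blast
  next
    case False
    have "infinite {i. k i \<le> n i}"
    proof
      assume "finite {i. k i \<le> n i}"
      moreover have "{i. n i \<le> k i} \<union> {i. k i \<le> n i} = UNIV" by auto
      ultimately show False using False by (metis finite_UnI infinite_UNIV_nat)
    qed
    moreover have "inj (\<lambda>i. (k i, n i))" using assms(1) unfolding inj_def prod.inject by blast
    moreover have "card (patterns (\<eta> \<circ> prod.swap) ({0..<int (k i)} \<times> {0..<int (n i)})) \<le> k i * n i" for i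
      using card_patterns_swap[of "{0..<int (k i)}" "{0..<int (n i)}" \<eta>] P[of i] by (simp add: mult.commute)
    ultimately have "few_tall_patterns (\<eta> \<circ> prod.swap)"
      using assms(3) by (intro few_tall_patternsI[of k n "{i. k i \<le> n i}"]) auto
    then have "subexp_squares (\<eta> \<circ> prod.swap) \<or> (\<exists>L>0. \<forall>m. (\<eta> \<circ> prod.swap) (m + (0, L)) = (\<eta> \<circ> prod.swap) m)"
      by (rule few_tall_patterns_dichotomy)
    then show ?thesis
    proof
      assume "\<exists>L>0. \<forall>m. (\<eta> \<circ> prod.swap) (m + (0, L)) = (\<eta> \<circ> prod.swap) m"
      then obtain L where L: "L > 0" "\<And>m. (\<eta> \<circ> prod.swap) (m + (0, L)) = (\<eta> \<circ> prod.swap) m" by blast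
      have "\<eta> (m + (L, 0)) = \<eta> m" for m using L(2)[of "prod.swap m"] by (cases m) simp
      then show ?thesis using L(1) by blast
    qed (use subexp_squares_swap in blast)
  qed
  moreover have zero: ?thesis if "subexp_squares \<eta>" using subexp_squares_imp_dir_entropy_zero[OF that] by blast
  moreover have ?thesis if L: "L > 0" "\<And>m. \<eta> (m + (0, L)) = \<eta> m" for L
  proof -
    have "(0, L) \<noteq> 0" using L by (simp add: zero_prod_def)
    from periodic_dichotomy[where \<eta> = \<eta> and p = "(0, L)", OF L(2) this] show ?thesis
    proof
      assume "nonexpansive_directions \<eta> = {span {pt (0, L)}} \<and> periodic_in_direction \<eta> (pt (0, L))"
      then have "nonexpansive_directions \<eta> = {span {(0, 1)}} \<and> periodic_in_direction \<eta> (0, 1)"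
        unfolding periodic_in_direction_def span_axis_period(1)[OF L(1)] .
      then show ?thesis by simp
    qed (use zero in blast)
  qed
  moreover have ?thesis if L: "L > 0" "\<And>m. \<eta> (m + (L, 0)) = \<eta> m" for L
  proof -
    have "(L, 0) \<noteq> 0" using L by (simp add: zero_prod_def)
    from periodic_dichotomy[where \<eta> = \<eta> and p = "(L, 0)", OF L(2) this] show ?thesis
    proof
      assume "nonexpansive_directions \<eta> = {span {pt (L, 0)}} \<and> periodic_in_direction \<eta> (pt (L, 0))"
      then have "nonexpansive_directions \<eta> = {span {(1, 0)}} \<and> periodic_in_direction \<eta> (1, 0)"
        unfolding periodic_in_direction_def span_axis_period(2)[OF L(1)] .
      then show ?thesis by simp
    qed (use zero in blast)
  qed
  ultimately show ?thesis by blast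
qed

end
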